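(* Consider either the action of Thompson's group $F$ on the set of dyadic rationals in $(0,1)$, or the action of the group $F_{\mathbb{R}}$ on the set of all dyadic rationals. The action is $3$-Liouville if and only if for every integer $n\ge 3$ and every $\varepsilon>0$ there exists a finite nonempty set $W\subset \mathbb{N}\times\cdots\times\mathbb{N}$ ($n$-fold product) such that $$\Bigl|\bigcap_{\substack{1\le k\le n,\ 1\le i\le k,\\ k+1\le m\le n}}\bigl\{(p_i(x)+p_{i+1}(x)+\cdots+p_k(x),\ p_{k+1}(x)+\cdots+p_m(x)) : x\in W\bigr\}\Bigr|\ \ge\ (1-\varepsilon)|W|,$$ where the sets being intersected are considered with multiplicities.
   Context: $\mathbb{N}=\{1,2,3,\dots\}$ and $p_i$ is the projection onto the $i$-th coordinate. Each set $\{\phi(x): x\in W\}$ in the intersection is a multiset, in which a pair $z\in\mathbb{N}\times\mathbb{N}$ has multiplicity $|\{x\in W: \phi(x)=z\}|$. The intersection of multisets assigns to each $z$ the minimum of its multiplicities, and $|\cdot|$ of a multiset is the sum of its multiplicities. The intersection runs over all triples $(i,k,m)$ with $1\le i\le k<m\le n$. $F_{\mathbb{R}}$ is the group of all piecewise linear homeomorphisms of $\mathbb{R}$ (with finitely many breakpoints, mapping the set $\mathbb{Z}[1/2]$ of dyadic rationals onto itself) whose slopes are powers of $2$ and whose breaking points of the first derivative are dyadic rationals. Thompson's group $F$ is the subgroup of $F_{\mathbb{R}}$ consisting of the homeomorphisms that are the identity outside $[0,1]$. For a countable discrete group $G$ acting on a set $Y$, a probability measure $\mu$ on $G$ is non-degenerate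 if its support generates $G$ as a semigroup. Put $p_\mu(x,y)=\sum_{g\in G,\ gx=y}\mu(g)$ for $x,y\in Y$. A function $f:Y\to\mathbb{R}$ is $\mu$-harmonic if $f(x)=\sum_{y\in Y}f(y)p_\mu(x,y)$ for all $x\in Y$. The action of $G$ on $Y$ is $\mu$-Liouville if all bounded $\mu$-harmonic functions on $Y$ are constant, and Liouville if it is $\mu$-Liouville for some non-degenerate probability measure $\mu$ on $G$. For a set $X$ let $\mathcal{P}_n(X)$ be the set of all subsets of $X$ of cardinality $n$. An action of $G$ on $X$ is $n$-Liouville if the induced action of $G$ on $\mathcal{P}_n(X)$, given by $g\cdot A=\{ga: a\in A\}$, is Liouville. *)

theory Defs
  imports
    "HOL-Probability.Probability_Mass_Function"
    "HOL-Algebra.Group_Action"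
    "HOL-Library.Ramsey"
begin

section \<open>Random walks on group actions and the Liouville property\<close>

inductive_set semigroup_generated :: "('g, 'b) monoid_scheme \<Rightarrow> 'g set \<Rightarrow> 'g set"
  for G and S where
  base: "s \<in> S \<Longrightarrow> s \<in> semigroup_generated G S"
| mult: "g \<in> semigroup_generated G S \<Longrightarrow> h \<in> semigroup_generated G S
    \<Longrightarrow> g \<otimes>\<^bsub>G\<^esub> h \<in> semigroup_generated G S"

text \<open>
  The type of \<open>g\<close> may be larger than the group, so a probability measure on the discrete group
  \<open>G\<close> is a probability mass function supported on the carrier.
\<close>

definition prob_measure_on_group :: "('g, 'b) monoid_scheme \<Rightarrow> 'g pmf \<Rightarrow> bool" where
  "prob_measure_on_group G \<mu> \<longleftrightarrow> set_pmf \<mu> \<subseteq> carrier G"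

definition nondegenerate :: "('g, 'b) monoid_scheme \<Rightarrow> 'g pmf \<Rightarrow> bool" where
  "nondegenerate G \<mu> \<longleftrightarrow> semigroup_generated G (set_pmf \<mu>) = carrier G"

definition transition ::
    "('g, 'b) monoid_scheme \<Rightarrow> ('g \<Rightarrow> 'y \<Rightarrow> 'y) \<Rightarrow> 'g pmf \<Rightarrow> 'y \<Rightarrow> 'y \<Rightarrow> real" where
  "transition G \<phi> \<mu> x y = (\<Sum>\<^sub>\<infinity>g\<in>{g \<in> carrier G. \<phi> g x = y}. pmf \<mu> g)"

definition harmonic ::
    "('g, 'b) monoid_scheme \<Rightarrow> 'y set \<Rightarrow> ('g \<Rightarrow> 'y \<Rightarrow> 'y) \<Rightarrow> 'g pmf \<Rightarrow> ('y \<Rightarrow> real) \<Rightarrow> bool" where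
  "harmonic G Y \<phi> \<mu> f \<longleftrightarrow>
     (\<forall>x\<in>Y. ((\<lambda>y. f y * transition G \<phi> \<mu> x y) has_sum f x) Y)"

definition mu_Liouville ::
    "('g, 'b) monoid_scheme \<Rightarrow> 'y set \<Rightarrow> ('g \<Rightarrow> 'y \<Rightarrow> 'y) \<Rightarrow> 'g pmf \<Rightarrow> bool" where
  "mu_Liouville G Y \<phi> \<mu> \<longleftrightarrow>
     (\<forall>f. bounded (f ` Y) \<and> harmonic G Y \<phi> \<mu> f \<longrightarrow> f constant_on Y)"

definition Liouville ::
    "('g, 'b) monoid_scheme \<Rightarrow> 'y set \<Rightarrow> ('g \<Rightarrow> 'y \<Rightarrow> 'y) \<Rightarrow> bool" where
  "Liouville G Y \<phi> \<longleftrightarrow>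
     (\<exists>\<mu>. prob_measure_on_group G \<mu> \<and> nondegenerate G \<mu> \<and> mu_Liouville G Y \<phi> \<mu>)"

definition induced_action :: "nat \<Rightarrow> 'x set \<Rightarrow> ('g \<Rightarrow> 'x \<Rightarrow> 'x) \<Rightarrow> 'g \<Rightarrow> 'x set \<Rightarrow> 'x set" where
  "induced_action n X \<phi> g = (\<lambda>A\<in>nsets X n. \<phi> g ` A)"

definition n_Liouville ::
    "nat \<Rightarrow> ('g, 'b) monoid_scheme \<Rightarrow> 'x set \<Rightarrow> ('g \<Rightarrow> 'x \<Rightarrow> 'x) \<Rightarrow> bool" where
  "n_Liouville n G X \<phi> \<longleftrightarrow> Liouville G (nsets X n) (induced_action n X \<phi>)"

lemma (in group_action) group_action_induced:
  "group_action G (nsets E n) (induced_action n E \<phi>)"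
proof -
  have grp: "group G" using group_hom by (simp add: group_hom_def)
  interpret G: group G by (rule grp)
  have img: "\<phi> g ` A \<in> nsets E n" if "g \<in> carrier G" "A \<in> nsets E n" for g A
    using that inj_prop[of g] surj_prop[of g]
    by (auto simp: nsets_def card_image inj_on_subset)
  have comp: "\<phi> g ` \<phi> h ` A = \<phi> (g \<otimes> h) ` A"
    if "g \<in> carrier G" "h \<in> carrier G" "A \<subseteq> E" for g h A
    using that composition_rule[of _ g h] by (force simp: image_image intro: image_cong)
  have one: "\<phi> \<one> ` A = A" if "A \<subseteq> E" for A
    using that by (force simp: id_eq_one[symmetric])
  have sub: "A \<subseteq> E" if "A \<in> nsets E n" for A
    using that by (simp add: nsets_def)
  have bij: "induced_action n E \<phi> g \<in> Bij (nsets E n)" if g: "g \<in> carrier G" for g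
  proof -
    have g': "inv g \<in> carrier G" using g by simp
    have "bij_betw (induced_action n E \<phi> g) (nsets E n) (nsets E n)"
    proof (rule bij_betw_byWitness[where f' = "induced_action n E \<phi> (inv g)"])
      show "\<forall>A\<in>nsets E n. induced_action n E \<phi> (inv g) (induced_action n E \<phi> g A) = A"
        using img[OF g] comp[OF g' g] one sub g by (simp add: induced_action_def)
      show "\<forall>A\<in>nsets E n. induced_action n E \<phi> g (induced_action n E \<phi> (inv g) A) = A"
        using img[OF g'] comp[OF g g'] one sub g by (simp add: induced_action_def)
    qed (use img[OF g] img[OF g'] in \<open>auto simp: induced_action_def\<close>)
    then show ?thesis
      by (simp add: Bij_def induced_action_def)
  qed
  have "induced_action n E \<phi> (g \<otimes> h)
      = compose (nsets E n) (induced_action n E \<phi> g) (induced_action n E \<phi> h)"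
    if "g \<in> carrier G" "h \<in> carrier G" for g h
    using img[OF that(2)] comp[OF that] sub
    by (simp add: fun_eq_iff compose_def induced_action_def)
  then have "induced_action n E \<phi> \<in> hom G (BijGroup (nsets E n))"
    using bij by (auto simp: hom_def BijGroup_def)
  then show ?thesis
    by (simp add: group_action_def group_hom_def group_hom_axioms_def grp group_BijGroup)
qed


section \<open>Thompson's group and its analogue on the real line\<close>

text \<open>The library constant \<open>dyadics\<close> contains only the nonnegative dyadic rationals.\<close>

definition dyadic_rationals :: "real set" where
  "dyadic_rationals = {of_int a / 2 ^ k | (a::int) (k::nat). True}"

text \<open>
  The breakpoints are among the points of \<open>B\<close>, and \<open>I\<close> ranges over all intervals (possibly
  unbounded) avoiding \<open>B\<close>. The slopes are integral, possibly negative, powers of two.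
\<close>

definition dyadic_PL :: "(real \<Rightarrow> real) \<Rightarrow> bool" where
  "dyadic_PL f \<longleftrightarrow>
     (\<exists>B. finite B \<and> B \<subseteq> dyadic_rationals \<and>
        (\<forall>I. is_interval I \<and> I \<inter> B = {} \<longrightarrow>
           (\<exists>(k::int) c. \<forall>x\<in>I. f x = 2 powi k * x + c)))"

definition PL_homeos :: "(real \<Rightarrow> real) set" where
  "PL_homeos = {f. (\<exists>f'. homeomorphism UNIV UNIV f f') \<and> dyadic_PL f \<and> f ` dyadic_rationals = dyadic_rationals}"

definition F_real :: "(real \<Rightarrow> real) monoid" where
  "F_real = \<lparr>carrier = PL_homeos, mult = (\<circ>), one = id\<rparr>"

definition thompson_F :: "(real \<Rightarrow> real) monoid" where
  "thompson_F = F_real\<lparr>carrier := {f \<in> PL_homeos. \<forall>x. x \<notin> {0..1} \<longrightarrow> f x = x}\<rparr>"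

definition eval_action :: "real set \<Rightarrow> (real \<Rightarrow> real) \<Rightarrow> real \<Rightarrow> real" where
  "eval_action X g = (\<lambda>x\<in>X. g x)"

lemma PL_homeos_breaks:
  assumes "f \<in> PL_homeos"
  obtains B where "finite B" "B \<subseteq> dyadic_rationals"
    "\<And>I. is_interval I \<Longrightarrow> I \<inter> B = {} \<Longrightarrow> \<exists>(k::int) c. \<forall>x\<in>I. f x = 2 powi k * x + c"
proof -
  have "dyadic_PL f" using assms by (simp add: PL_homeos_def)
  then show thesis unfolding dyadic_PL_def by (elim exE conjE) (erule (1) that, simp)
qed

lemma id_in_PL_homeos: "id \<in> PL_homeos"
proof -
  have "dyadic_PL id"
    unfolding dyadic_PL_def
    by (rule exI[of _ "{}"], auto intro!: exI[of _ "0::int"] exI[of _ "0::real"])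
  moreover have "homeomorphism UNIV UNIV (id::real\<Rightarrow>real) id"
    by (simp add: homeomorphism_def)
  ultimately show ?thesis by (auto simp: PL_homeos_def)
qed

lemma PL_homeos_comp:
  assumes f: "f \<in> PL_homeos" and g: "g \<in> PL_homeos"
  shows "f \<circ> g \<in> PL_homeos"
proof -
  obtain f' g' where hf: "homeomorphism UNIV UNIV f f'" and hg: "homeomorphism UNIV UNIV g g'"
    using f g by (auto simp: PL_homeos_def)
  have df: "f ` dyadic_rationals = dyadic_rationals" and dg: "g ` dyadic_rationals = dyadic_rationals"
    using f g by (auto simp: PL_homeos_def)
  obtain B where B: "finite B" "B \<subseteq> dyadic_rationals"
    and BI: "\<And>I. is_interval I \<Longrightarrow> I \<inter> B = {} \<Longrightarrow> \<exists>(k::int) c. \<forall>x\<in>I. f x = 2 powi k * x + c"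
    using PL_homeos_breaks[OF f] by metis
  obtain C where C: "finite C" "C \<subseteq> dyadic_rationals"
    and CI: "\<And>I. is_interval I \<Longrightarrow> I \<inter> C = {} \<Longrightarrow> \<exists>(k::int) c. \<forall>x\<in>I. g x = 2 powi k * x + c"
    using PL_homeos_breaks[OF g] by metis
  have gg: "g' (g x) = x" "g (g' x) = x" for x
    using hg by (auto simp: homeomorphism_def)
  let ?D = "C \<union> g' ` B"
  have "finite ?D" using B C by simp
  moreover have "?D \<subseteq> dyadic_rationals"
  proof -
    have "g' b \<in> dyadic_rationals" if "b \<in> B" for b
    proof -
      have "b \<in> g ` dyadic_rationals" using that B dg by auto
      then show ?thesis by (auto simp: gg)
    qed
    then show ?thesis using C by auto
  qed
  moreover have "\<exists>(k::int) c. \<forall>x\<in>I. (f \<circ> g) x = 2 powi k * x + c"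
    if I: "is_interval I" "I \<inter> ?D = {}" for I
  proof -
    obtain l d where l: "\<forall>x\<in>I. g x = 2 powi (l::int) * x + d" using CI[of I] I by blast
    have "connected (g ` I)"
      using I hg by (intro connected_continuous_image)
        (auto simp: is_interval_connected_1 homeomorphism_def intro: continuous_on_subset)
    then have "is_interval (g ` I)" by (simp add: is_interval_connected_1)
    moreover have "g ` I \<inter> B = {}" using I by (force simp: gg image_iff)
    ultimately obtain k c where k: "\<forall>x\<in>g ` I. f x = 2 powi (k::int) * x + c" using BI by meson
    have "\<forall>x\<in>I. (f \<circ> g) x = 2 powi (k + l) * x + (2 powi k * d + c)"
      using l k by (auto simp: power_int_add algebra_simps)
    then show ?thesis by blast
  qed
  ultimately have "dyadic_PL (f \<circ> g)"
    unfolding dyadic_PL_def by (intro exI[of _ ?D]) simp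
  moreover have "homeomorphism UNIV UNIV (f \<circ> g) (g' \<circ> f')"
    using homeomorphism_compose[OF hg hf] .
  moreover have "(f \<circ> g) ` dyadic_rationals = dyadic_rationals" using df dg by (metis image_comp)
  ultimately show ?thesis unfolding PL_homeos_def by blast
qed

lemma PL_homeos_inv:
  assumes f: "f \<in> PL_homeos"
  shows "\<exists>f'\<in>PL_homeos. f' \<circ> f = id \<and> f \<circ> f' = id"
proof -
  obtain f' where hf: "homeomorphism UNIV UNIV f f'"
    using f by (auto simp: PL_homeos_def)
  have df: "f ` dyadic_rationals = dyadic_rationals"
    using f by (auto simp: PL_homeos_def)
  obtain B where B: "finite B" "B \<subseteq> dyadic_rationals"
    and BI: "\<And>I. is_interval I \<Longrightarrow> I \<inter> B = {} \<Longrightarrow> \<exists>(k::int) c. \<forall>x\<in>I. f x = 2 powi k * x + c"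
    using PL_homeos_breaks[OF f] by metis
  have ff: "f' (f x) = x" "f (f' x) = x" for x
    using hf by (auto simp: homeomorphism_def)
  have "finite (f ` B)" "f ` B \<subseteq> dyadic_rationals" using B df by auto
  moreover have "\<exists>(k::int) c. \<forall>x\<in>I. f' x = 2 powi k * x + c"
    if I: "is_interval I" "I \<inter> f ` B = {}" for I
  proof -
    have "connected (f' ` I)"
      using I hf by (intro connected_continuous_image)
        (auto simp: is_interval_connected_1 homeomorphism_def intro: continuous_on_subset)
    then have "is_interval (f' ` I)" by (simp add: is_interval_connected_1)
    moreover have "f' ` I \<inter> B = {}" using I by (force simp: ff image_iff)
    ultimately obtain k c where k: "\<forall>x\<in>f' ` I. f x = 2 powi (k::int) * x + c" using BI by meson
    have "f' x = 2 powi (-k) * x + (- (2 powi (-k) * c))" if "x \<in> I" for x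
    proof -
      have "x = 2 powi k * f' x + c" using k that ff by (metis imageI)
      then have "2 powi (-k) * x = 2 powi (-k) * (2 powi k * f' x + c)" by simp
      then show ?thesis by (simp add: power_int_minus field_simps)
    qed
    then show ?thesis by blast
  qed
  ultimately have "dyadic_PL f'"
    unfolding dyadic_PL_def by (intro exI[of _ "f ` B"]) simp
  moreover have "f' ` dyadic_rationals = dyadic_rationals"
  proof -
    have "f' ` f ` dyadic_rationals = dyadic_rationals" by (simp add: image_image ff)
    then show ?thesis by (simp add: df)
  qed
  moreover have "homeomorphism UNIV UNIV f' f" using hf by (simp add: homeomorphism_symD)
  ultimately have "f' \<in> PL_homeos" unfolding PL_homeos_def by blast
  moreover have "f' \<circ> f = id" "f \<circ> f' = id" by (auto simp: ff)
  ultimately show ?thesis by blast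
qed

lemma group_F_real: "group F_real"
proof (rule groupI)
  fix f assume "f \<in> carrier F_real"
  then show "\<exists>g\<in>carrier F_real. g \<otimes>\<^bsub>F_real\<^esub> f = \<one>\<^bsub>F_real\<^esub>"
    using PL_homeos_inv[of f] by (auto simp: F_real_def)
qed (auto simp: F_real_def PL_homeos_comp id_in_PL_homeos comp_assoc)

lemma F_real_m_inv:
  assumes "f \<in> PL_homeos" "f' \<circ> f = id" "f' \<in> PL_homeos"
  shows "m_inv F_real f = f'"
proof -
  interpret group F_real by (rule group_F_real)
  show ?thesis
    using assms by (intro inv_equality) (auto simp: F_real_def)
qed

lemma subgroup_thompson_F: "subgroup (carrier thompson_F) F_real"
proof -
  interpret group F_real by (rule group_F_real)
  show ?thesis
  proof (rule subgroupI)
    show "carrier thompson_F \<subseteq> carrier F_real" by (auto simp: thompson_F_def F_real_def)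
    show "carrier thompson_F \<noteq> {}"
      using id_in_PL_homeos by (auto simp: thompson_F_def)
  next
    fix f assume f: "f \<in> carrier thompson_F"
    then have fP: "f \<in> PL_homeos" and fx: "\<And>x. x \<notin> {0..1} \<Longrightarrow> f x = x"
      by (auto simp: thompson_F_def)
    obtain f' where f': "f' \<in> PL_homeos" "f' \<circ> f = id" using PL_homeos_inv[OF fP] by blast
    have "f' x = x" if "x \<notin> {0..1}" for x
      using fx[OF that] f'(2) by (metis comp_apply id_apply)
    then show "m_inv F_real f \<in> carrier thompson_F"
      using F_real_m_inv[OF fP f'(2,1)] f'(1) by (auto simp: thompson_F_def)
  next
    fix f g assume "f \<in> carrier thompson_F" "g \<in> carrier thompson_F"
    then show "f \<otimes>\<^bsub>F_real\<^esub> g \<in> carrier thompson_F"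
      using PL_homeos_comp[of f g] by (auto simp: thompson_F_def F_real_def)
  qed
qed

lemma group_thompson_F: "group thompson_F"
proof -
  have "thompson_F = F_real\<lparr>carrier := carrier thompson_F\<rparr>" by (simp add: thompson_F_def)
  then show ?thesis
    using subgroup.subgroup_is_group[OF subgroup_thompson_F group_F_real] by simp
qed

lemma group_action_evalI:
  assumes "group G" and mult: "\<And>g h. g \<otimes>\<^bsub>G\<^esub> h = g \<circ> h"
    and bij: "\<And>g. g \<in> carrier G \<Longrightarrow> bij_betw g X X"
  shows "group_action G X (eval_action X)"
proof -
  have "eval_action X g \<in> Bij X" if "g \<in> carrier G" for g
    using bij[OF that] by (simp add: Bij_def eval_action_def)
  moreover have "eval_action X (g \<otimes>\<^bsub>G\<^esub> h) = compose X (eval_action X g) (eval_action X h)"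
    if "h \<in> carrier G" for g h
    using bij[OF that] by (auto simp: fun_eq_iff mult compose_def eval_action_def bij_betw_def)
  ultimately have "eval_action X \<in> hom G (BijGroup X)"
    by (auto simp: hom_def BijGroup_def)
  then show ?thesis
    using \<open>group G\<close>
    by (simp add: group_action_def group_hom_def group_hom_axioms_def group_BijGroup)
qed

lemma PL_homeos_bij: "f \<in> PL_homeos \<Longrightarrow> bij f"
  using PL_homeos_inv[of f] o_bij by blast

lemma group_action_F_real: "group_action F_real dyadic_rationals (eval_action dyadic_rationals)"
proof (rule group_action_evalI[OF group_F_real])
  fix g assume "g \<in> carrier F_real"
  then have "g \<in> PL_homeos" by (simp add: F_real_def)
  then show "bij_betw g dyadic_rationals dyadic_rationals"
    using PL_homeos_bij[of g] by (auto simp: PL_homeos_def bij_betw_def intro: inj_on_subset)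
qed (simp add: F_real_def)

lemma thompson_F_maps_01:
  assumes f: "f \<in> carrier thompson_F"
  shows "f ` {0<..<1} = {0<..<1}"
proof -
  have fP: "f \<in> PL_homeos" and fx: "\<And>x. x \<notin> {0..1} \<Longrightarrow> f x = x"
    using f by (auto simp: thompson_F_def)
  have cont: "isCont f x" for x
    using fP by (auto simp: PL_homeos_def homeomorphism_def continuous_on_eq_continuous_at)
  have bij: "bij f" by (rule PL_homeos_bij[OF fP])
  have "eventually (\<lambda>x. x = f x) (at_left (0::real))"
    by (rule eventually_mono[OF eventually_at_left_real[of "-1" 0]]) (auto simp: fx)
  moreover have "(f \<longlongrightarrow> f 0) (at_left 0)"
    using cont[of 0] by (simp add: isCont_def filterlim_at_split)
  ultimately have "((\<lambda>x. x) \<longlongrightarrow> f 0) (at_left 0)" by (simp add: tendsto_cong)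
  then have f0: "f 0 = 0"
    by (intro tendsto_unique[OF trivial_limit_at_left_real _ tendsto_ident_at])
  have "eventually (\<lambda>x. x = f x) (at_right (1::real))"
    by (rule eventually_mono[OF eventually_at_right_real[of 1 2]]) (auto simp: fx)
  moreover have "(f \<longlongrightarrow> f 1) (at_right 1)"
    using cont[of 1] by (simp add: isCont_def filterlim_at_split)
  ultimately have "((\<lambda>x. x) \<longlongrightarrow> f 1) (at_right 1)" by (simp add: tendsto_cong)
  then have f1: "f 1 = 1"
    by (intro tendsto_unique[OF trivial_limit_at_right_real _ tendsto_ident_at])
  have outside: "f x = x" if "x \<in> - {0<..<1}" for x
    using fx[of x] f0 f1 that by (cases "x = 0"; cases "x = 1") auto
  have "f ` (- {0<..<1}) = (\<lambda>x. x) ` (- {0<..<1})"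
    by (intro image_cong) (use outside in auto)
  then have "f ` (- {0<..<1}) = - {0<..<1}" by simp
  then show ?thesis
    using bij_image_Compl_eq[OF bij, of "{0<..<1}"] by auto
qed

lemma group_action_thompson_F:
  "group_action thompson_F (dyadic_rationals \<inter> {0<..<1}) (eval_action (dyadic_rationals \<inter> {0<..<1}))"
proof (rule group_action_evalI[OF group_thompson_F])
  fix g assume g: "g \<in> carrier thompson_F"
  then have gP: "g \<in> PL_homeos" by (simp add: thompson_F_def)
  then have "inj g" using PL_homeos_bij bij_is_inj by blast
  moreover have "g ` (dyadic_rationals \<inter> {0<..<1}) = dyadic_rationals \<inter> {0<..<1}"
    using gP thompson_F_maps_01[OF g] \<open>inj g\<close> by (simp add: image_Int PL_homeos_def)
  ultimately show "bij_betw g (dyadic_rationals \<inter> {0<..<1}) (dyadic_rationals \<inter> {0<..<1})"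
    by (auto simp: bij_betw_def intro: inj_on_subset)
qed (simp add: thompson_F_def F_real_def)


section \<open>Multisets of sums of consecutive coordinates\<close>

definition block_sums :: "(nat \<Rightarrow> nat) set \<Rightarrow> nat \<Rightarrow> nat \<Rightarrow> nat \<Rightarrow> (nat \<times> nat) multiset" where
  "block_sums W i k m = image_mset (\<lambda>x. (\<Sum>j=i..k. x j, \<Sum>j=k+1..m. x j)) (mset_set W)"

text \<open>
  The infimum of a nonempty set of multisets takes pointwise minima of multiplicities; it is a
  genuine minimum over all the triples as soon as \<open>n \<ge> 2\<close>, and is \<open>{#}\<close> by convention otherwise.
\<close>

definition block_sums_inter :: "(nat \<Rightarrow> nat) set \<Rightarrow> nat \<Rightarrow> (nat \<times> nat) multiset" where
  "block_sums_inter W n =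
     Inf {block_sums W i k m | i k m. 1 \<le> i \<and> i \<le> k \<and> k < m \<and> m \<le> n}"

lemma count_block_sums:
  assumes "finite W"
  shows "count (block_sums W i k m) z
    = card {x \<in> W. (\<Sum>j=i..k. x j, \<Sum>j=k+1..m. x j) = z}"
  using assms
  by (auto simp: block_sums_def count_image_mset vimage_def Int_def conj_commute
      intro!: arg_cong[where f = card])

end

theory Submission
  imports Defs "HOL-Probability.Product_PMF"
begin

text \<open>
  For a probability measure \<open>\<nu>\<close> on the group and a triple \<open>A\<close>, the law of \<open>A\<close> under \<open>\<nu>\<close> is the
  distribution of the random triple \<open>g A\<close> when \<open>g\<close> has distribution \<open>\<nu>\<close>. Both sides of the
  equivalence are equivalent to one merging condition: for any finitely many triples and any
  \<open>\<epsilon> > 0\<close>, some \<open>\<nu>\<close> makes the laws of these triples pairwise \<open>\<epsilon>\<close>-close in total variation.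

  The equivalence of merging with the Liouville property holds for every action of a countable
  group on a countable set. Suppose first that \<open>\<mu>\<close> has no nonconstant bounded harmonic functions.
  The averages of its first \<open>n\<close> convolution powers are almost invariant under one more step of the
  walk. If they failed to merge two points, bounded functions witnessing this would have a pointwise
  limit along a subsequence; the limit would be harmonic and would separate the two points
  (\<open>Liouville_imp_nearly_merging\<close>). Conversely, given merging measures, choose \<open>\<nu> i\<close> one after the
  other so that \<open>\<nu> i\<close> merges all the points that the earlier measures can produce from the first
  few points in a large number of steps, and let \<open>\<mu>\<close> be the mixture of the \<open>\<nu> i\<close> with geometric
  weights. The \<open>\<mu>\<close>-walk almost surely uses measures of arbitrarily large index, and the first one
  with index at least \<open>m\<close> merges, up to a small error, whatever came before. So any two starting
  points are merged by the walk, and a bounded harmonic function takes the same value at both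
  (\<open>nearly_merging_imp_Liouville\<close>).

  Merging for triples of dyadic rationals becomes arithmetic because the group consists of increasing
  maps and is transitive on increasing tuples of any length. Fix points \<open>y 0 < \<dots> < y n\<close>. After
  multiplication by a power of two, the images of these points under finitely many group elements
  are integers, and each group element gives the tuple \<open>x\<close> of the \<open>n\<close> successive distances. The
  triple consisting of \<open>y (i - 1)\<close>, \<open>y k\<close> and \<open>y m\<close> is moved to a triple with distances
  \<open>x i + \<dots> + x k\<close> and \<open>x (k + 1) + \<dots> + x m\<close>. If the laws of the triples are close, so are the
  multisets of these pairs (\<open>block_sums_of_Liouville\<close>). In the other direction, place the points at
  the partial sums of a random element of \<open>W\<close>, starting at a uniformly random place of a very long
  interval. The random starting place blurs the position of a triple, so that its law nearly depends
  only on the law of its two distances (\<open>nearly_merging_of_block_sums\<close>).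

  One obstacle remains: \<open>W\<close> must be a set, whereas different group elements can give the same tuple of
  distances, so that merging measures produce a multiset of tuples. Repetitions are removed in
  \<open>multiset_realized_by_set\<close>. The point with index \<open>j\<close> is moved by \<open>3 ^ s j\<close>, where the marking
  \<open>s\<close> ranges over those functions from \<open>{0..n}\<close> to \<open>{0..<p}\<close> whose sum has one of \<open>c\<close> prescribed
  residues modulo \<open>p\<close>, and \<open>c\<close> is the multiplicity of the tuple. There are \<open>n + 1 \<ge> 4\<close> points; once
  the marks of the three points of a triple are fixed, another mark is free to adjust the sum.
  Hence every triple sees each combination of three marks equally often, with a frequency
  proportional to \<open>c\<close>, and the proportion of common pairs does not change.
\<close>

section \<open>Bounded harmonic functions as expectations\<close>

lemma integrable_pmf_bounded:
  fixes f :: "'a \<Rightarrow> real"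
  assumes "\<And>x. x \<in> set_pmf p \<Longrightarrow> \<bar>f x\<bar> \<le> B"
  shows "integrable (measure_pmf p) f"
  using assms by (intro measure_pmf.integrable_const_bound[where B = B]) (auto simp: AE_measure_pmf_iff)

lemma abs_expectation_le:
  fixes f :: "'a \<Rightarrow> real"
  assumes "\<And>x. x \<in> set_pmf p \<Longrightarrow> \<bar>f x\<bar> \<le> B"
  shows "\<bar>measure_pmf.expectation p f\<bar> \<le> B"
proof -
  have i: "integrable (measure_pmf p) f" by (rule integrable_pmf_bounded[OF assms])
  have "measure_pmf.expectation p f \<le> measure_pmf.expectation p (\<lambda>_. B)"
    using assms by (intro integral_mono_AE i) (force simp: AE_measure_pmf_iff abs_le_iff)+
  moreover have "measure_pmf.expectation p (\<lambda>_. -B) \<le> measure_pmf.expectation p f"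
    using assms by (intro integral_mono_AE i) (force simp: AE_measure_pmf_iff abs_le_iff)+
  ultimately show ?thesis by simp
qed

lemma expectation_bind_pmf:
  fixes f :: "'a \<Rightarrow> real"
  assumes "\<And>x. \<bar>f x\<bar> \<le> B"
  shows "measure_pmf.expectation (bind_pmf p q) f
    = measure_pmf.expectation p (\<lambda>x. measure_pmf.expectation (q x) f)"
  unfolding measure_pmf_bind
  using assms
  by (intro integral_bind[where K = "count_space UNIV" and B = B and B' = 1])
     (auto simp: measure_pmf_in_subprob_space measure_pmf.emeasure_space_1
       space_subprob_algebra intro!: prob_space_imp_subprob_space measure_pmf.prob_space_axioms)

text \<open>
  The transition probability from \<open>x\<close> to \<open>y\<close> is the mass at \<open>y\<close> of the image of \<open>\<mu>\<close> under
  \<open>g \<mapsto> g x\<close>, so that summing \<open>f\<close> against it is a change of variables.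
\<close>
lemma (in group_action) transition_has_sum:
  assumes \<mu>: "set_pmf \<mu> \<subseteq> carrier G" and f: "\<And>z. z \<in> E \<Longrightarrow> \<bar>f z\<bar> \<le> B" and x: "x \<in> E"
  shows "((\<lambda>y. f y * transition G \<phi> \<mu> x y) has_sum
    measure_pmf.expectation \<mu> (\<lambda>g. f (\<phi> g x))) E"
proof -
  define p where "p = map_pmf (\<lambda>g. \<phi> g x) \<mu>"
  have setp: "set_pmf p \<subseteq> E"
    using \<mu> element_image x by (fastforce simp: p_def)
  have tr: "transition G \<phi> \<mu> x y = pmf p y" for y
  proof -
    have "pmf p y = measure (measure_pmf \<mu>) ((\<lambda>g. \<phi> g x) -` {y})"
      by (simp add: p_def pmf_map)
    also have "\<dots> = measure (measure_pmf \<mu>) {g \<in> carrier G. \<phi> g x = y}"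
      using \<mu> by (intro measure_pmf.finite_measure_eq_AE) (auto simp: AE_measure_pmf_iff)
    also have "\<dots> = (\<Sum>\<^sub>\<infinity>g\<in>{g \<in> carrier G. \<phi> g x = y}. pmf \<mu> g)"
      by (subst measure_pmf_conv_infsetsum, rule infsetsum_infsum) (rule pmf_abs_summable)
    finally show ?thesis by (simp add: transition_def)
  qed
  define h where "h = (\<lambda>y. pmf p y * (if y \<in> E then f y else 0))"
  have abs: "h abs_summable_on UNIV"
  proof (rule abs_summable_on_comparison_test'[where g = "\<lambda>y. \<bar>B\<bar> * pmf p y"])
    show "(\<lambda>y. \<bar>B\<bar> * pmf p y) abs_summable_on UNIV"
      by (intro abs_summable_on_cmult_right pmf_abs_summable)
    fix y show "norm (h y) \<le> \<bar>B\<bar> * pmf p y"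
    proof (cases "y \<in> E")
      case True
      then have "\<bar>f y\<bar> \<le> \<bar>B\<bar>" using f[of y] by linarith
      then show ?thesis using True by (simp add: h_def abs_mult mult.commute mult_right_mono)
    qed (simp add: h_def)
  qed
  have "h summable_on UNIV"
    by (rule abs_summable_summable) (simp only: abs_summable_equivalent abs)
  then have "(h has_sum infsum h UNIV) UNIV" by (rule has_sum_infsum)
  also have "infsum h UNIV = infsetsum h UNIV" by (rule infsetsum_infsum[OF abs, symmetric])
  also have "\<dots> = measure_pmf.expectation p (\<lambda>y. if y \<in> E then f y else 0)"
    by (subst pmf_expectation_eq_infsetsum) (simp only: h_def)
  also have "\<dots> = measure_pmf.expectation p f"
    using setp by (intro integral_cong_AE) (auto simp: AE_measure_pmf_iff)
  also have "\<dots> = measure_pmf.expectation \<mu> (\<lambda>g. f (\<phi> g x))"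
    by (simp add: p_def)
  finally have "(h has_sum measure_pmf.expectation \<mu> (\<lambda>g. f (\<phi> g x))) UNIV" .
  moreover have "(h has_sum s) UNIV \<longleftrightarrow> ((\<lambda>y. f y * transition G \<phi> \<mu> x y) has_sum s) E" for s
    by (intro has_sum_cong_neutral) (auto simp: h_def tr)
  ultimately show ?thesis by simp
qed

lemma (in group_action) harmonic_iff_expectation:
  assumes "set_pmf \<mu> \<subseteq> carrier G" and "\<And>z. z \<in> E \<Longrightarrow> \<bar>f z\<bar> \<le> B"
  shows "harmonic G E \<phi> \<mu> f \<longleftrightarrow>
    (\<forall>x\<in>E. f x = measure_pmf.expectation \<mu> (\<lambda>g. f (\<phi> g x)))"
proof -
  have "((\<lambda>y. f y * transition G \<phi> \<mu> x y) has_sum f x) E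
      \<longleftrightarrow> f x = measure_pmf.expectation \<mu> (\<lambda>g. f (\<phi> g x))" if "x \<in> E" for x
    using transition_has_sum[of \<mu> f B x] assms that by (metis has_sum_unique)
  then show ?thesis by (simp add: harmonic_def)
qed

text \<open>
  Tychonoff's theorem for countable products of intervals. The index set is transported to the
  natural numbers, for which the product topology on functions is first countable and compactness
  gives convergent subsequences.
\<close>
lemma pointwise_convergent_subsequence:
  fixes u :: "nat \<Rightarrow> 'a \<Rightarrow> real"
  assumes Y: "countable Y" and u: "\<And>n y. y \<in> Y \<Longrightarrow> \<bar>u n y\<bar> \<le> B"
  obtains r v where "strict_mono (r :: nat \<Rightarrow> nat)" "\<And>y. y \<in> Y \<Longrightarrow> (\<lambda>n. u (r n) y) \<longlonglongrightarrow> v y"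
proof -
  define c :: "nat \<Rightarrow> nat \<Rightarrow> real" where
    "c n i = (if i \<in> to_nat_on Y ` Y then u n (from_nat_into Y i) else 0)" for n i
  have "compact (PiE UNIV (\<lambda>_::nat. {-\<bar>B\<bar>..\<bar>B\<bar>}))"
    using compactin_PiE[of "\<lambda>_. euclidean" UNIV "\<lambda>_::nat. {-\<bar>B\<bar>..\<bar>B\<bar>}"]
    by (simp add: euclidean_product_topology)
  then have "seq_compact (PiE UNIV (\<lambda>_::nat. {-\<bar>B\<bar>..\<bar>B\<bar>}))" by (rule compact_imp_seq_compact)
  moreover have "c n \<in> PiE UNIV (\<lambda>_. {-\<bar>B\<bar>..\<bar>B\<bar>})" for n
  proof -
    have "\<bar>c n i\<bar> \<le> \<bar>B\<bar>" for i
      using u[of "from_nat_into Y i" n] Y by (auto simp: c_def)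
    then show ?thesis by (auto simp: abs_le_iff) (metis minus_le_iff)
  qed
  ultimately obtain l r where r: "strict_mono (r :: nat \<Rightarrow> nat)" and l: "(c \<circ> r) \<longlonglongrightarrow> l"
    by (metis seq_compactE)
  have "(\<lambda>n. u (r n) y) \<longlonglongrightarrow> l (to_nat_on Y y)" if y: "y \<in> Y" for y
  proof -
    have "continuous_on UNIV (\<lambda>x::nat\<Rightarrow>real. x (to_nat_on Y y))"
      by (rule continuous_on_product_coordinates)
    then have "isCont (\<lambda>x::nat\<Rightarrow>real. x (to_nat_on Y y)) l"
      using continuous_on_eq_continuous_at[OF open_UNIV] by blast
    from isCont_tendsto_compose[OF this l] show ?thesis
      using y Y by (simp add: c_def)
  qed
  with r show thesis by (rule that)
qed

section \<open>Liouville actions have merging measures\<close>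

text \<open>
  Total variation in dual form: a test function bounded by 1 cannot distinguish the laws of \<open>x\<close> and
  \<open>y\<close> by more than \<open>\<epsilon>\<close>. This form applies directly to bounded harmonic functions, and its
  failure hands over the functions from which a harmonic one is built.
\<close>
definition nearly_merges :: "('g \<Rightarrow> 'y \<Rightarrow> 'y) \<Rightarrow> 'g pmf \<Rightarrow> 'y set \<Rightarrow> real \<Rightarrow> bool" where
  "nearly_merges \<phi> \<nu> K \<epsilon> \<longleftrightarrow> (\<forall>x\<in>K. \<forall>y\<in>K. \<forall>f. (\<forall>z. \<bar>f z\<bar> \<le> 1) \<longrightarrow>
     \<bar>measure_pmf.expectation \<nu> (\<lambda>g. f (\<phi> g x)) - measure_pmf.expectation \<nu> (\<lambda>g. f (\<phi> g y))\<bar> \<le> \<epsilon>)"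

text \<open>
  The new factor is applied first, so that the expectation of \<open>f (h x)\<close> under the power \<open>Suc k\<close> is
  obtained by applying the Markov operator of \<open>\<mu>\<close> to the corresponding function for the power \<open>k\<close>.
\<close>
primrec conv_power :: "('g, 'b) monoid_scheme \<Rightarrow> 'g pmf \<Rightarrow> nat \<Rightarrow> 'g pmf" where
  "conv_power G \<mu> 0 = return_pmf \<one>\<^bsub>G\<^esub>"
| "conv_power G \<mu> (Suc k) = bind_pmf \<mu> (\<lambda>g. map_pmf (\<lambda>h. h \<otimes>\<^bsub>G\<^esub> g) (conv_power G \<mu> k))"

lemma (in group_action) set_conv_power:
  assumes "set_pmf \<mu> \<subseteq> carrier G"
  shows "set_pmf (conv_power G \<mu> k) \<subseteq> carrier G"
proof -
  interpret G: group G using group_hom by (simp add: group_hom_def)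
  show ?thesis using assms by (induction k) auto
qed

lemma (in group_action) expectation_conv_power_Suc:
  assumes \<mu>: "set_pmf \<mu> \<subseteq> carrier G" and f: "\<And>z. \<bar>f z :: real\<bar> \<le> B" and x: "x \<in> E"
  shows "measure_pmf.expectation (conv_power G \<mu> (Suc k)) (\<lambda>h. f (\<phi> h x))
    = measure_pmf.expectation \<mu> (\<lambda>g. measure_pmf.expectation (conv_power G \<mu> k) (\<lambda>h. f (\<phi> h (\<phi> g x))))"
proof -
  have "measure_pmf.expectation (conv_power G \<mu> (Suc k)) (\<lambda>h. f (\<phi> h x))
    = measure_pmf.expectation \<mu> (\<lambda>g. measure_pmf.expectation (conv_power G \<mu> k) (\<lambda>h. f (\<phi> (h \<otimes> g) x)))"
    using f by (simp add: expectation_bind_pmf[where B = B])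
  also have "\<dots> = measure_pmf.expectation \<mu>
      (\<lambda>g. measure_pmf.expectation (conv_power G \<mu> k) (\<lambda>h. f (\<phi> h (\<phi> g x))))"
    using set_conv_power[OF \<mu>] \<mu> composition_rule[OF x]
    by (intro integral_cong_AE AE_pmfI; (simp; fail)?) (auto simp: subset_iff intro!: integral_cong_AE AE_pmfI)
  finally show ?thesis .
qed

text \<open>
  If no averaged convolution power merges \<open>K\<close>, then for each \<open>n\<close> some test function \<open>f n\<close> separates
  two points of \<open>K\<close> after averaging. The averaged functions \<open>u n\<close> are harmonic up to an error
  \<open>2 / (n + 1)\<close> by telescoping, so that every pointwise limit of them is harmonic; and along a
  subsequence on which the separated pair is constant the limit still separates this pair.
\<close>
theorem (in group_action) Liouville_imp_nearly_merging:
  assumes L: "Liouville G E \<phi>" and E: "countable E" and K: "finite K" "K \<subseteq> E" and \<epsilon>: "\<epsilon> > 0"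
  shows "\<exists>\<nu>. set_pmf \<nu> \<subseteq> carrier G \<and> nearly_merges \<phi> \<nu> K \<epsilon>"
proof (rule ccontr)
  assume none: "\<not> ?thesis"
  obtain \<mu> where \<mu>: "set_pmf \<mu> \<subseteq> carrier G" and \<mu>L: "mu_Liouville G E \<phi> \<mu>"
    using L by (auto simp: Liouville_def prob_measure_on_group_def)
  define avg where "avg n = bind_pmf (pmf_of_set {..n}) (conv_power G \<mu>)" for n :: nat
  have "set_pmf (avg n) \<subseteq> carrier G" for n
    using set_conv_power[OF \<mu>] by (auto simp: avg_def)
  then have "\<exists>x\<in>K. \<exists>y\<in>K. \<exists>f. (\<forall>z. \<bar>f z\<bar> \<le> 1) \<and>
      \<not> \<bar>measure_pmf.expectation (avg n) (\<lambda>g. f (\<phi> g x)) - measure_pmf.expectation (avg n) (\<lambda>g. f (\<phi> g y))\<bar> \<le> \<epsilon>" for n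
    using none unfolding nearly_merges_def by meson
  then obtain X Y f where XY: "\<And>n. X n \<in> K" "\<And>n. Y n \<in> K" and f: "\<And>n z. \<bar>f n z\<bar> \<le> (1::real)"
    and far: "\<And>n. \<not> \<bar>measure_pmf.expectation (avg n) (\<lambda>g. f n (\<phi> g (X n)))
      - measure_pmf.expectation (avg n) (\<lambda>g. f n (\<phi> g (Y n)))\<bar> \<le> \<epsilon>"
    by metis
  define w where "w k n z = measure_pmf.expectation (conv_power G \<mu> k) (\<lambda>h. f n (\<phi> h z))" for k n z
  define u where "u n z = measure_pmf.expectation (avg n) (\<lambda>h. f n (\<phi> h z))" for n z
  have w1: "\<bar>w k n z\<bar> \<le> 1" for k n z unfolding w_def by (rule abs_expectation_le) (rule f)
  have u1: "\<bar>u n z\<bar> \<le> 1" for n z unfolding u_def by (rule abs_expectation_le) (rule f)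
  have u_eq: "u n z = (\<Sum>k\<le>n. w k n z) / (n + 1)" for n z
    unfolding u_def avg_def w_def
    by (subst expectation_bind_pmf[where B = 1]) (simp_all add: f integral_pmf_of_set add.commute)
  have step: "measure_pmf.expectation \<mu> (\<lambda>g. w k n (\<phi> g z)) = w (Suc k) n z" if "z \<in> E" for k n z
    unfolding w_def by (rule expectation_conv_power_Suc[OF \<mu> f that, symmetric])
  have almost: "\<bar>measure_pmf.expectation \<mu> (\<lambda>g. u n (\<phi> g z)) - u n z\<bar> \<le> 2 / real (Suc n)"
    if z: "z \<in> E" for n z
  proof -
    have "measure_pmf.expectation \<mu> (\<lambda>g. u n (\<phi> g z)) = (\<Sum>k\<le>n. w (Suc k) n z) / (n + 1)"
      unfolding u_eq using step[OF z] by (simp add: integrable_pmf_bounded[OF w1])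
    then have "measure_pmf.expectation \<mu> (\<lambda>g. u n (\<phi> g z)) - u n z
        = (\<Sum>k\<le>n. w (Suc k) n z - w k n z) / (n + 1)"
      by (simp add: u_eq sum_subtractf diff_divide_distrib)
    also have "(\<Sum>k\<le>n. w (Suc k) n z - w k n z) = w (Suc n) n z - w 0 n z"
      using sum_telescope[of "\<lambda>k. - w k n z" n] by simp
    finally have "\<bar>measure_pmf.expectation \<mu> (\<lambda>g. u n (\<phi> g z)) - u n z\<bar>
        = \<bar>w (Suc n) n z - w 0 n z\<bar> / (n + 1)" by simp
    also have "\<dots> \<le> 2 / (n + 1)"
      using w1[of "Suc n" n z] w1[of 0 n z] by (intro divide_right_mono) linarith+
    finally show ?thesis by (simp add: add.commute)
  qed
  \<comment> \<open>The separated pair depends on \<open>n\<close>, but there are finitely many pairs in \<open>K\<close>.\<close>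
  have "finite (range (\<lambda>n. (X n, Y n)))"
    by (rule finite_subset[of _ "K \<times> K"]) (use XY K in auto)
  then obtain n0 where "infinite {n. (X n, Y n) = (X n0, Y n0)}"
    using pigeonhole_infinite[of UNIV "\<lambda>n. (X n, Y n)"] by auto
  then obtain s :: "nat \<Rightarrow> nat" where s: "strict_mono s" and sXY: "\<And>n. X (s n) = X n0" "\<And>n. Y (s n) = Y n0"
    using infinite_enumerate[of "{n. (X n, Y n) = (X n0, Y n0)}"] by auto
  obtain r v where r: "strict_mono (r :: nat \<Rightarrow> nat)"
    and lim: "\<And>z. z \<in> E \<Longrightarrow> (\<lambda>n. u (s (r n)) z) \<longlonglongrightarrow> v z"
    using pointwise_convergent_subsequence[OF E, of "\<lambda>n. u (s n)" 1] u1 by blast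
  have v1: "\<bar>v z\<bar> \<le> 1" if "z \<in> E" for z
    using tendsto_rabs[OF lim[OF that]] by (rule LIMSEQ_le_const2) (use u1 in auto)
  have gE: "\<phi> g z \<in> E" if "g \<in> set_pmf \<mu>" "z \<in> E" for g z
    using that \<mu> element_image by blast
  have "v z = measure_pmf.expectation \<mu> (\<lambda>g. v (\<phi> g z))" if z: "z \<in> E" for z
  proof -
    \<comment> \<open>Applying the Markov operator commutes with the limit by dominated convergence.\<close>
    have "(\<lambda>n. measure_pmf.expectation \<mu> (\<lambda>g. u (s (r n)) (\<phi> g z)))
        \<longlonglongrightarrow> measure_pmf.expectation \<mu> (\<lambda>g. v (\<phi> g z))"
      by (rule integral_dominated_convergence[where w = "\<lambda>_. 1"])
         (use u1 lim gE z in \<open>auto simp: AE_measure_pmf_iff\<close>)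
    then have "(\<lambda>n. measure_pmf.expectation \<mu> (\<lambda>g. u (s (r n)) (\<phi> g z)) - u (s (r n)) z)
        \<longlonglongrightarrow> measure_pmf.expectation \<mu> (\<lambda>g. v (\<phi> g z)) - v z"
      by (intro tendsto_diff lim z)
    moreover have "(\<lambda>n. measure_pmf.expectation \<mu> (\<lambda>g. u (s (r n)) (\<phi> g z)) - u (s (r n)) z) \<longlonglongrightarrow> 0"
    proof (rule Lim_null_comparison)
      have "(\<lambda>n. 2 / real (Suc n)) \<longlonglongrightarrow> 0" by (rule LIMSEQ_Suc[OF lim_const_over_n])
      from LIMSEQ_subseq_LIMSEQ[OF this strict_mono_o[OF s r]]
      show "(\<lambda>n. 2 / real (Suc (s (r n)))) \<longlonglongrightarrow> 0" by (simp add: o_def)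
    qed (use almost[OF z] in auto)
    ultimately show ?thesis using LIMSEQ_unique by fastforce
  qed
  then have "harmonic G E \<phi> \<mu> v"
    by (subst harmonic_iff_expectation[OF \<mu>, where B = 1]) (use v1 in auto)
  moreover have "bounded (v ` E)" using v1 by (auto simp: bounded_iff)
  ultimately have "v constant_on E" using \<mu>L by (auto simp: mu_Liouville_def)
  then have "v (X n0) = v (Y n0)" using XY[of n0] K unfolding constant_on_def by (metis subsetD)
  moreover have "\<epsilon> \<le> \<bar>v (X n0) - v (Y n0)\<bar>"
  proof (rule LIMSEQ_le_const)
    show "(\<lambda>n. \<bar>u (s (r n)) (X n0) - u (s (r n)) (Y n0)\<bar>) \<longlonglongrightarrow> \<bar>v (X n0) - v (Y n0)\<bar>"
      using XY[of n0] K by (intro tendsto_rabs tendsto_diff lim) auto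
    show "\<exists>N. \<forall>n\<ge>N. \<epsilon> \<le> \<bar>u (s (r n)) (X n0) - u (s (r n)) (Y n0)\<bar>"
      using far sXY by (auto simp: u_def) (metis linear)
  qed
  ultimately show False using \<epsilon> by simp
qed

section \<open>Merging measures make an action Liouville\<close>

primrec reachable :: "('g \<Rightarrow> 'y \<Rightarrow> 'y) \<Rightarrow> 'g set \<Rightarrow> 'y set \<Rightarrow> nat \<Rightarrow> 'y set" where
  "reachable \<phi> T K 0 = K"
| "reachable \<phi> T K (Suc n) = reachable \<phi> T K n \<union> (\<Union>g\<in>T. \<phi> g ` reachable \<phi> T K n)"

lemma finite_reachable: "finite T \<Longrightarrow> finite K \<Longrightarrow> finite (reachable \<phi> T K n)"
  by (induction n) auto

lemma (in group_action) reachable_subset: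
  "T \<subseteq> carrier G \<Longrightarrow> K \<subseteq> E \<Longrightarrow> reachable \<phi> T K n \<subseteq> E"
proof (induction n)
  case (Suc n)
  then show ?case using element_image by (fastforce simp: subset_iff)
qed simp

lemma reachable_mono:
  assumes "T \<subseteq> T'" "K \<subseteq> K'" "n \<le> n'"
  shows "reachable \<phi> T K n \<subseteq> reachable \<phi> T' K' n'"
proof -
  have "reachable \<phi> T K n \<subseteq> reachable \<phi> T' K' n"
    using assms(1,2) by (induction n) (auto, blast+)
  also have "\<dots> \<subseteq> reachable \<phi> T' K' n'"
    using assms(3) by (induction n' rule: dec_induct) auto
  finally show ?thesis .
qed

lemma nearly_merges_mono:
  "nearly_merges \<phi> \<nu> K \<epsilon> \<Longrightarrow> K' \<subseteq> K \<Longrightarrow> \<epsilon> \<le> \<epsilon>' \<Longrightarrow> nearly_merges \<phi> \<nu> K' \<epsilon>'"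
  unfolding nearly_merges_def by (meson order_trans subsetD)

text \<open>
  Giving a small weight to a prescribed element costs little merging. This is how the final measure
  becomes non-degenerate.
\<close>
lemma (in group_action) nearly_merging_containing:
  assumes \<nu>: "finite (set_pmf \<nu>)" "set_pmf \<nu> \<subseteq> carrier G" "nearly_merges \<phi> \<nu> K (\<epsilon>/2)"
    and g: "g \<in> carrier G" and \<epsilon>: "0 < \<epsilon>"
  obtains \<nu>' where "finite (set_pmf \<nu>')" "set_pmf \<nu>' \<subseteq> carrier G" "nearly_merges \<phi> \<nu>' K \<epsilon>" "g \<in> set_pmf \<nu>'"
proof -
  \<comment> \<open>The point mass at \<open>g\<close> contributes at most \<open>2 d\<close> to a difference of expectations.\<close>
  define d where "d = min (1/2) (\<epsilon>/4)"
  have d: "0 < d" "d < 1" "2 * d \<le> \<epsilon>/2" using \<epsilon> by (auto simp: d_def)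
  define \<nu>' where "\<nu>' = bind_pmf (bernoulli_pmf d) (\<lambda>b. if b then return_pmf g else \<nu>)"
  have s: "set_pmf \<nu>' = insert g (set_pmf \<nu>)"
    using d by (auto simp: \<nu>'_def set_pmf_bernoulli split: if_splits)
  have "\<bar>measure_pmf.expectation \<nu>' (\<lambda>g. f (\<phi> g x)) - measure_pmf.expectation \<nu>' (\<lambda>g. f (\<phi> g y))\<bar> \<le> \<epsilon>"
    if xy: "x \<in> K" "y \<in> K" and f: "\<forall>z. \<bar>f z\<bar> \<le> 1" for x y f
  proof -
    have ex: "measure_pmf.expectation \<nu>' (\<lambda>g. f (\<phi> g z))
      = d * f (\<phi> g z) + (1 - d) * measure_pmf.expectation \<nu> (\<lambda>g. f (\<phi> g z))" for z
      unfolding \<nu>'_def using f d by (subst expectation_bind_pmf[where B = 1]) auto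
    let ?D = "measure_pmf.expectation \<nu> (\<lambda>g. f (\<phi> g x)) - measure_pmf.expectation \<nu> (\<lambda>g. f (\<phi> g y))"
    have D: "\<bar>?D\<bar> \<le> \<epsilon>/2" using \<nu>(3) xy f by (auto simp: nearly_merges_def)
    have "measure_pmf.expectation \<nu>' (\<lambda>g. f (\<phi> g x)) - measure_pmf.expectation \<nu>' (\<lambda>g. f (\<phi> g y))
      = d * (f (\<phi> g x) - f (\<phi> g y)) + (1 - d) * ?D"
      by (simp add: ex algebra_simps)
    also have "\<bar>\<dots>\<bar> \<le> d * 2 + 1 * (\<epsilon>/2)"
    proof -
      have "\<bar>f (\<phi> g x) - f (\<phi> g y)\<bar> \<le> 2"
        using f[rule_format, of "\<phi> g x"] f[rule_format, of "\<phi> g y"] by linarith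
      then have "\<bar>d * (f (\<phi> g x) - f (\<phi> g y))\<bar> \<le> d * 2"
        using d by (simp add: abs_mult)
      moreover have "\<bar>(1 - d) * ?D\<bar> \<le> 1 * (\<epsilon>/2)"
        unfolding abs_mult using d D by (intro mult_mono) auto
      ultimately show ?thesis by linarith
    qed
    finally show ?thesis using d by linarith
  qed
  then have "nearly_merges \<phi> \<nu>' K \<epsilon>" by (auto simp: nearly_merges_def)
  then show thesis using that[of \<nu>'] s \<nu> g by auto
qed

text \<open>
  The choice of each measure depends on the supports of all the earlier ones. Finite supports keep
  the set of reachable points finite, which is what makes the next choice possible.
\<close>
lemma (in group_action) merging_sequence:
  fixes M :: "nat \<Rightarrow> nat" and P :: "nat \<Rightarrow> 'c set"
  assumes G: "countable (carrier G)" and P: "\<And>i. finite (P i)" "\<And>i. P i \<subseteq> E"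
    and merging: "\<And>K \<epsilon>. finite K \<Longrightarrow> K \<subseteq> E \<Longrightarrow> \<epsilon> > 0 \<Longrightarrow>
      \<exists>\<nu>. finite (set_pmf \<nu>) \<and> set_pmf \<nu> \<subseteq> carrier G \<and> nearly_merges \<phi> \<nu> K \<epsilon>"
  obtains \<nu> where "\<And>i. set_pmf (\<nu> i) \<subseteq> carrier G" "(\<Union>i. set_pmf (\<nu> i)) = carrier G"
    "\<And>i. nearly_merges \<phi> (\<nu> i) (reachable \<phi> (\<Union>j<i. set_pmf (\<nu> j)) (P i) (M i)) (1 / real (Suc i))"
proof -
  interpret G: group G using group_hom by (simp add: group_hom_def)
  have enum: "from_nat_into (carrier G) i \<in> carrier G" for i
    by (rule from_nat_into) (use G.one_closed in blast)
  have ex: "\<exists>\<nu>. finite (set_pmf \<nu>) \<and> set_pmf \<nu> \<subseteq> carrier G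
      \<and> nearly_merges \<phi> \<nu> (reachable \<phi> T (P i) (M i)) (1 / real (Suc i))
      \<and> from_nat_into (carrier G) i \<in> set_pmf \<nu>"
    if T: "finite T" "T \<subseteq> carrier G" for T i
  proof -
    have "finite (reachable \<phi> T (P i) (M i))" "reachable \<phi> T (P i) (M i) \<subseteq> E"
      using finite_reachable[OF T(1) P(1)] reachable_subset[OF T(2) P(2)] by auto
    then obtain \<nu>0 where \<nu>0: "finite (set_pmf \<nu>0)" "set_pmf \<nu>0 \<subseteq> carrier G"
      "nearly_merges \<phi> \<nu>0 (reachable \<phi> T (P i) (M i)) (1 / real (Suc i) / 2)"
      using merging[of "reachable \<phi> T (P i) (M i)" "1 / real (Suc i) / 2"] by auto
    obtain \<nu> where "finite (set_pmf \<nu>)" "set_pmf \<nu> \<subseteq> carrier G"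
      "nearly_merges \<phi> \<nu> (reachable \<phi> T (P i) (M i)) (1 / real (Suc i))"
      "from_nat_into (carrier G) i \<in> set_pmf \<nu>"
      by (rule nearly_merging_containing[OF \<nu>0 enum[of i]]) simp_all
    then show ?thesis by blast
  qed
  \<comment> \<open>The state of the recursion is the union of the supports so far together with the next measure.\<close>
  have "\<exists>f. \<forall>i. (finite (fst (f i)) \<and> fst (f i) \<subseteq> carrier G \<and> finite (set_pmf (snd (f i)))
      \<and> set_pmf (snd (f i)) \<subseteq> carrier G
      \<and> nearly_merges \<phi> (snd (f i)) (reachable \<phi> (fst (f i)) (P i) (M i)) (1 / real (Suc i))
      \<and> from_nat_into (carrier G) i \<in> set_pmf (snd (f i)) \<and> (i = 0 \<longrightarrow> fst (f i) = {}))
    \<and> fst (f (Suc i)) = fst (f i) \<union> set_pmf (snd (f i))"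
    (is "\<exists>f. \<forall>i. ?P i (f i) \<and> ?Q (f i) (f (Suc i))")
  proof (rule dependent_nat_choice[of "\<lambda>i f. ?P i f" "\<lambda>_ f f'. ?Q f f'"])
    obtain \<nu>0 where "?P 0 ({}, \<nu>0)" using ex[of "{}" 0] by (simp only: fst_conv snd_conv) blast
    then show "\<exists>f. ?P 0 f" by blast
    fix f i assume f: "?P i f"
    then obtain \<nu>' where "?P (Suc i) (fst f \<union> set_pmf (snd f), \<nu>')"
      using ex[of "fst f \<union> set_pmf (snd f)" "Suc i"] by (simp only: fst_conv snd_conv) blast
    then have "?P (Suc i) (fst f \<union> set_pmf (snd f), \<nu>') \<and> ?Q f (fst f \<union> set_pmf (snd f), \<nu>')" by simp
    then show "\<exists>f'. ?P (Suc i) f' \<and> ?Q f f'" by blast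
  qed
  then obtain f where fi: "\<forall>i. ?P i (f i) \<and> ?Q (f i) (f (Suc i))" by (rule exE)
  have f: "?P i (f i)" and fS: "?Q (f i) (f (Suc i))" for i
    using fi[THEN spec, of i] by (rule conjunct1, rule conjunct2)
  have T: "fst (f i) = (\<Union>j<i. set_pmf (snd (f j)))" for i
  proof (induction i)
    case (Suc i)
    then show ?case using fS[of i] by (auto simp: lessThan_Suc)
  qed (use f[of 0] in simp)
  have "carrier G \<subseteq> (\<Union>i. set_pmf (snd (f i)))"
  proof
    fix g assume "g \<in> carrier G"
    then have "from_nat_into (carrier G) (to_nat_on (carrier G) g) = g" using G by simp
    then have "g \<in> set_pmf (snd (f (to_nat_on (carrier G) g)))"
      using f[of "to_nat_on (carrier G) g"] by simp
    then show "g \<in> (\<Union>i. set_pmf (snd (f i)))" by blast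
  qed
  moreover have "(\<Union>i. set_pmf (snd (f i))) \<subseteq> carrier G" using f by (intro UN_least) simp
  ultimately show thesis
    using f by (intro that[of "\<lambda>i. snd (f i)"]) (simp_all only: T[symmetric] subset_antisym)
qed

text \<open>
  The construction of Kaimanovich and Vershik. Fix \<open>m\<close> and let \<open>q m < 1\<close> be the probability that the
  geometrically distributed index is below \<open>m\<close>. By harmonicity, the oscillation of a harmonic
  function \<open>f\<close> with \<open>\<bar>f\<bar> \<le> 1\<close> over the points reachable in \<open>n\<close> steps of index below \<open>m\<close> is at most \<open>q m\<close>
  times the oscillation over the points reachable in \<open>n + 1\<close> steps, plus \<open>1 - q m\<close> times the
  merging error \<open>\<epsilon> = 1 / (m + 1)\<close>. Iterating \<open>M m\<close> times bounds the oscillation over the first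
  \<open>m\<close> points by \<open>\<epsilon> + 2 (q m) ^ M m\<close>, and this tends to 0 as \<open>m\<close> grows.
\<close>
theorem (in group_action) nearly_merging_imp_Liouville:
  assumes G: "countable (carrier G)" and E: "countable E"
    and merging: "\<And>K \<epsilon>. finite K \<Longrightarrow> K \<subseteq> E \<Longrightarrow> \<epsilon> > 0 \<Longrightarrow>
      \<exists>\<nu>. finite (set_pmf \<nu>) \<and> set_pmf \<nu> \<subseteq> carrier G \<and> nearly_merges \<phi> \<nu> K \<epsilon>"
  shows "Liouville G E \<phi>"
proof -
  interpret G: group G using group_hom by (simp add: group_hom_def)
  define geo where "geo = geometric_pmf (1/2)"
  have geo: "set_pmf geo = UNIV" by (simp add: geo_def set_pmf_geometric)
  define q where "q m = measure (measure_pmf geo) {..<m}" for m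
  have q: "0 \<le> q m" "q m < 1" for m
  proof -
    have "q m + pmf geo m = measure (measure_pmf geo) ({..<m} \<union> {m})"
      by (subst measure_pmf.finite_measure_Union) (auto simp: q_def measure_pmf_single)
    also have "\<dots> \<le> 1" by simp
    finally show "q m < 1" using pmf_positive[of m geo] by (simp add: geo)
  qed (simp add: q_def)
  have "\<exists>N. \<forall>n\<ge>N. 2 * q m ^ n \<le> 1 / real (Suc m)" for m
  proof -
    have "(\<lambda>n. 2 * q m ^ n) \<longlonglongrightarrow> 2 * 0"
      by (intro tendsto_mult tendsto_const LIMSEQ_realpow_zero q)
    then have "\<forall>\<^sub>F n in sequentially. 2 * q m ^ n < 1 / real (Suc m)"
      by (rule order_tendstoD) simp
    then show ?thesis unfolding eventually_sequentially by (auto intro: less_imp_le)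
  qed
  then obtain N where N: "\<And>m n. N m \<le> n \<Longrightarrow> 2 * q m ^ n \<le> 1 / real (Suc m)"
    using choice[of "\<lambda>m N. \<forall>n\<ge>N. 2 * q m ^ n \<le> 1 / real (Suc m)"] by auto
  \<comment> \<open>A monotone bound, so that \<open>\<nu> i\<close> also merges the points relevant for every \<open>m \<le> i\<close>.\<close>
  define M where "M i = (\<Sum>j\<le>i. N j)" for i
  have M_mono: "M i \<le> M j" if "i \<le> j" for i j
    using that by (auto simp: M_def intro!: sum_mono2)
  have NM: "N i \<le> M i" for i by (simp add: M_def member_le_sum)
  define P where "P i = from_nat_into E ` {..<i} \<inter> E" for i
  have P_mono: "P i \<subseteq> P j" if "i \<le> j" for i j using that by (auto simp: P_def)
  obtain \<nu> where \<nu>: "\<And>i. set_pmf (\<nu> i) \<subseteq> carrier G" "(\<Union>i. set_pmf (\<nu> i)) = carrier G"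
    and merge: "\<And>i. nearly_merges \<phi> (\<nu> i) (reachable \<phi> (\<Union>j<i. set_pmf (\<nu> j)) (P i) (M i)) (1 / real (Suc i))"
    by (rule merging_sequence[OF G _ _ merging, of P M]) (auto simp: P_def)
  define \<mu> where "\<mu> = bind_pmf geo \<nu>"
  have set_\<mu>: "set_pmf \<mu> = carrier G" using \<nu>(2) by (simp add: \<mu>_def geo)
  have nondeg: "nondegenerate G \<mu>"
  proof -
    have "g \<in> carrier G" if "g \<in> semigroup_generated G (carrier G)" for g
      using that by induction auto
    then show ?thesis by (auto simp: nondegenerate_def set_\<mu> intro: semigroup_generated.base)
  qed
  have "h constant_on E" if bdd: "bounded (h ` E)" and harm: "harmonic G E \<phi> \<mu> h" for h
  proof -
    obtain B where B: "\<And>z. z \<in> E \<Longrightarrow> \<bar>h z\<bar> \<le> B"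
      using bdd by (auto simp: bounded_iff)
    define C where "C = \<bar>B\<bar> + 1"
    have C: "C > 0" by (simp add: C_def)
    have hC: "\<bar>h z\<bar> \<le> C" if "z \<in> E" for z using B[OF that] by (simp add: C_def)
    \<comment> \<open>Test functions are bounded everywhere, while \<open>h\<close> is controlled on \<open>E\<close> only.\<close>
    define f where "f z = (if z \<in> E then h z / C else 0)" for z
    have f1: "\<bar>f z\<bar> \<le> 1" for z using hC[of z] C by (auto simp: f_def)
    have gE: "\<phi> g z \<in> E" if "g \<in> carrier G" "z \<in> E" for g z
      using that element_image by blast
    have hx: "h x = measure_pmf.expectation \<mu> (\<lambda>g. h (\<phi> g x))" if "x \<in> E" for x
      using harm harmonic_iff_expectation[of \<mu> h B] B set_\<mu> that by simp
    define a where "a i z = measure_pmf.expectation (\<nu> i) (\<lambda>g. f (\<phi> g z))" for i z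
    have a1: "\<bar>a i z\<bar> \<le> 1" for i z unfolding a_def by (rule abs_expectation_le) (rule f1)
    have fx: "f x = measure_pmf.expectation geo (\<lambda>i. a i x)" if x: "x \<in> E" for x
    proof -
      have "f x = measure_pmf.expectation \<mu> (\<lambda>g. h (\<phi> g x) / C)"
        using hx[OF x] x by (simp add: f_def)
      also have "\<dots> = measure_pmf.expectation \<mu> (\<lambda>g. f (\<phi> g x))"
        by (intro integral_cong_AE AE_pmfI) (use gE x in \<open>auto simp: f_def set_\<mu>\<close>)
      finally show ?thesis
        unfolding \<mu>_def a_def using f1 by (subst (asm) expectation_bind_pmf[where B = 1]) auto
    qed
    have close: "\<bar>f x - f y\<bar> \<le> 2 / real (Suc m)" if xy: "x \<in> P m" "y \<in> P m" for m x y
    proof -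
      define S where "S n = reachable \<phi> (\<Union>j<m. set_pmf (\<nu> j)) (P m) n" for n
      have S_E: "S n \<subseteq> E" for n
        unfolding S_def by (rule reachable_subset) (use \<nu>(1) in \<open>auto simp: P_def\<close>)
      define \<epsilon> where "\<epsilon> = 1 / real (Suc m)"
      have merge': "\<bar>a i x - a i y\<bar> \<le> \<epsilon>" if "m \<le> i" "x \<in> S n" "y \<in> S n" "n \<le> M m" for i n x y
      proof -
        have "S n \<subseteq> reachable \<phi> (\<Union>j<i. set_pmf (\<nu> j)) (P i) (M i)"
          unfolding S_def using that M_mono[of m i] P_mono[of m i]
          by (intro reachable_mono UN_mono) auto
        moreover have "1 / real (Suc i) \<le> \<epsilon>" using that by (simp add: \<epsilon>_def frac_le)
        ultimately have "nearly_merges \<phi> (\<nu> i) (S n) \<epsilon>"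
          using merge[of i] nearly_merges_mono by blast
        then show ?thesis using that f1 by (auto simp: nearly_merges_def a_def)
      qed
      \<comment> \<open>Backward induction on the number of steps: after \<open>M m\<close> steps only the trivial bound 2 is used.\<close>
      have "\<bar>f x - f y\<bar> \<le> \<epsilon> + 2 * q m ^ j" if "j \<le> M m" "x \<in> S (M m - j)" "y \<in> S (M m - j)" for j x y
        using that
      proof (induction j arbitrary: x y)
        case 0
        have "\<bar>f x - f y\<bar> \<le> 2" using f1[of x] f1[of y] by linarith
        moreover have "\<epsilon> \<ge> 0" by (simp add: \<epsilon>_def)
        ultimately show ?case by simp
      next
        case (Suc j)
        define c where "c = \<epsilon> + 2 * q m ^ j"
        have n: "M m - j = Suc (M m - Suc j)" using Suc.prems by simp
        have small: "\<bar>a i x - a i y\<bar> \<le> c" if i: "i < m" for i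
        proof -
          have "\<bar>f (\<phi> g x) - f (\<phi> g y)\<bar> \<le> c" if "g \<in> set_pmf (\<nu> i)" for g
            unfolding c_def
            by (rule Suc.IH) (use Suc.prems that i n in \<open>auto simp: S_def\<close>)
          then have "\<bar>measure_pmf.expectation (\<nu> i) (\<lambda>g. f (\<phi> g x) - f (\<phi> g y))\<bar> \<le> c"
            by (rule abs_expectation_le)
          then show ?thesis
            unfolding a_def by (subst (asm) Bochner_Integration.integral_diff)
              (auto intro: integrable_pmf_bounded[where B = 1] f1)
        qed
        have xyE: "x \<in> E" "y \<in> E" using Suc.prems S_E by auto
        have int: "integrable (measure_pmf geo) (\<lambda>i. a i z)" for z
          by (rule integrable_pmf_bounded[where B = 1]) (rule a1)
        have "f x - f y = measure_pmf.expectation geo (\<lambda>i. a i x - a i y)"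
          using fx[OF xyE(1)] fx[OF xyE(2)] int by simp
        also have "\<bar>\<dots>\<bar> \<le> measure_pmf.expectation geo (\<lambda>i. \<bar>a i x - a i y\<bar>)"
          by (rule integral_abs_bound)
        also have "\<dots> \<le> measure_pmf.expectation geo (\<lambda>i. \<epsilon> + indicator {..<m} i * (c - \<epsilon>))"
        proof (rule integral_mono)
          show "integrable (measure_pmf geo) (\<lambda>i. \<bar>a i x - a i y\<bar>)"
            using int by simp
          show "integrable (measure_pmf geo) (\<lambda>i. \<epsilon> + indicator {..<m} i * (c - \<epsilon>))"
            by (rule integrable_pmf_bounded[where B = "\<bar>\<epsilon>\<bar> + \<bar>c - \<epsilon>\<bar>"]) (auto simp: indicator_def)
          show "\<bar>a i x - a i y\<bar> \<le> \<epsilon> + indicator {..<m} i * (c - \<epsilon>)" for i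
            using small[of i] merge'[of i x "M m - Suc j" y] Suc.prems by (cases "i < m") auto
        qed
        also have "\<dots> = \<epsilon> + q m * (c - \<epsilon>)"
        proof -
          have "integrable (measure_pmf geo) (\<lambda>i. indicator {..<m} i * (c - \<epsilon>))"
            by (rule integrable_pmf_bounded[where B = "\<bar>c - \<epsilon>\<bar>"]) (auto simp: indicator_def)
          then show ?thesis by (simp add: q_def)
        qed
        also have "\<dots> = \<epsilon> + 2 * q m ^ Suc j" by (simp add: c_def)
        finally show ?case .
      qed
      from this[of "M m" x y] have "\<bar>f x - f y\<bar> \<le> \<epsilon> + 2 * q m ^ M m"
        using xy by (simp add: S_def)
      also have "\<dots> \<le> 2 / real (Suc m)" using N[OF NM, of m] by (simp add: \<epsilon>_def)
      finally show ?thesis .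
    qed
    have "f x = f y" if x: "x \<in> E" and y: "y \<in> E" for x y
    proof -
      define m0 where "m0 = Suc (max (to_nat_on E x) (to_nat_on E y))"
      have "x \<in> P m0" "y \<in> P m0"
        using x y E by (auto simp: P_def m0_def image_iff)
          (metis from_nat_into_to_nat_on lessThan_iff less_Suc_eq_le max.cobounded1 max.cobounded2)+
      then have *: "\<bar>f x - f y\<bar> \<le> 2 / real (Suc m)" if "m \<ge> m0" for m
        using close[of x m y] P_mono[OF that] by blast
      have "(\<lambda>m. 2 / real (Suc m)) \<longlonglongrightarrow> 0" by (rule LIMSEQ_Suc[OF lim_const_over_n])
      then have "\<bar>f x - f y\<bar> \<le> 0"
        by (rule LIMSEQ_le_const) (use * in blast)
      then show ?thesis by simp
    qed
    then have "h x / C = h y / C" if "x \<in> E" "y \<in> E" for x y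
      using that by (metis f_def)
    then have "h x = h y" if "x \<in> E" "y \<in> E" for x y
      using that C by (metis divide_cancel_right less_irrefl)
    then show ?thesis unfolding constant_on_def by blast
  qed
  then have "mu_Liouville G E \<phi> \<mu>" by (auto simp: mu_Liouville_def)
  then show ?thesis using nondeg set_\<mu> by (auto simp: Liouville_def prob_measure_on_group_def)
qed

section \<open>Dyadic piecewise linear homeomorphisms\<close>

lemma dyadic_add: "x \<in> dyadic_rationals \<Longrightarrow> y \<in> dyadic_rationals \<Longrightarrow> x + y \<in> dyadic_rationals"
proof -
  assume "x \<in> dyadic_rationals" "y \<in> dyadic_rationals"
  then obtain a b :: int and k l where "x = of_int a / 2 ^ k" "y = of_int b / 2 ^ l"
    by (auto simp: dyadic_rationals_def)
  then have "x + y = of_int (a * 2 ^ l + b * 2 ^ k) / 2 ^ (k + l)"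
    by (simp add: add_frac_eq power_add)
  then show ?thesis unfolding dyadic_rationals_def by blast
qed

lemma dyadic_of_int: "of_int a \<in> dyadic_rationals"
  unfolding dyadic_rationals_def by (rule CollectI, rule exI[of _ a], rule exI[of _ 0]) simp

lemma dyadic_mult: "x \<in> dyadic_rationals \<Longrightarrow> y \<in> dyadic_rationals \<Longrightarrow> x * y \<in> dyadic_rationals"
proof -
  assume "x \<in> dyadic_rationals" "y \<in> dyadic_rationals"
  then obtain a b :: int and k l where "x = of_int a / 2 ^ k" "y = of_int b / 2 ^ l"
    by (auto simp: dyadic_rationals_def)
  then have "x * y = of_int (a * b) / 2 ^ (k + l)" by (simp add: power_add)
  then show ?thesis unfolding dyadic_rationals_def by blast
qed

lemma dyadic_powi: "2 powi (k::int) \<in> dyadic_rationals"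
proof (cases "k \<ge> 0")
  case True
  then have "(2::real) powi k = of_int (2 ^ nat k)" by (simp add: power_int_def)
  then show ?thesis by (metis dyadic_of_int)
next
  case False
  then have "(2::real) powi k = of_int 1 / 2 ^ nat (- k)"
    by (simp add: power_int_def inverse_eq_divide power_one_over)
  then show ?thesis unfolding dyadic_rationals_def by blast
qed

lemma dyadic_diff: "x \<in> dyadic_rationals \<Longrightarrow> y \<in> dyadic_rationals \<Longrightarrow> x - y \<in> dyadic_rationals"
  using dyadic_add[of x "of_int (-1) * y"] dyadic_mult[OF dyadic_of_int[of "-1"], of y] by simp

lemma countable_dyadic_rationals: "countable dyadic_rationals"
proof -
  have eq: "dyadic_rationals = (\<lambda>(a::int, k::nat). of_int a / 2 ^ k) ` UNIV"
    by (auto simp: dyadic_rationals_def)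
  show ?thesis unfolding eq by (rule countable_image, rule countableI_type)
qed

text \<open>
  A homeomorphism of the line is monotone or antitone; on the unbounded interval to the right of all
  breakpoints the slope is a power of two, hence positive.
\<close>
lemma PL_homeos_strict_mono:
  assumes f: "f \<in> PL_homeos"
  shows "strict_mono f"
proof -
  obtain B where B: "finite B"
    and BI: "\<And>I. is_interval I \<Longrightarrow> I \<inter> B = {} \<Longrightarrow> \<exists>(k::int) c. \<forall>x\<in>I. f x = 2 powi k * x + c"
    using PL_homeos_breaks[OF f] by metis
  define M where "M = Max (insert 0 B)"
  have "{M<..} \<inter> B = {}"
    using B by (auto simp: M_def disjoint_iff not_less)
  then obtain k :: int and c where k: "\<And>x. M < x \<Longrightarrow> f x = 2 powi k * x + c"
    using BI[of "{M<..}"] is_interval_oi by (metis greaterThan_iff)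
  have up: "f (M + 1) < f (M + 2)" by (simp add: k)
  have "inj f" using PL_homeos_bij[OF f] by (rule bij_is_inj)
  moreover have "continuous_on UNIV f" using f by (auto simp: PL_homeos_def homeomorphism_def)
  ultimately have "strict_mono_on UNIV f \<or> strict_antimono_on UNIV f"
    using injective_eq_monotone_map[of UNIV f] by (simp add: is_interval_univ)
  moreover have "\<not> strict_antimono_on UNIV f"
    using up monotone_onD[of UNIV "(<)" "(>)" f "M + 1" "M + 2"] by auto
  ultimately show ?thesis by simp
qed

lemma affine_PL_homeos:
  assumes d: "d \<in> dyadic_rationals"
  shows "(\<lambda>x. 2 powi k * x + d) \<in> PL_homeos"
proof -
  let ?f = "\<lambda>x::real. 2 powi k * x + d" and ?g = "\<lambda>y::real. 2 powi (-k) * (y - d)"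
  have inv: "?f (?g y) = y" "?g (?f y) = y" for y by (simp_all add: power_int_minus mult.assoc[symmetric])
  have "homeomorphism UNIV UNIV ?f ?g"
    using inv by (intro homeomorphismI continuous_intros) auto
  moreover have "dyadic_PL ?f" unfolding dyadic_PL_def by (rule exI[of _ "{}"]) auto
  moreover have "?f ` dyadic_rationals = dyadic_rationals"
  proof
    show "?f ` dyadic_rationals \<subseteq> dyadic_rationals"
      using d by (auto intro: dyadic_add dyadic_mult dyadic_powi)
    show "dyadic_rationals \<subseteq> ?f ` dyadic_rationals"
    proof
      fix y assume "y \<in> dyadic_rationals"
      then have "?g y \<in> dyadic_rationals" using d by (intro dyadic_mult dyadic_powi dyadic_diff)
      then show "y \<in> ?f ` dyadic_rationals" using inv(1)[of y] by (metis imageI)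
    qed
  qed
  ultimately show ?thesis by (auto simp: PL_homeos_def)
qed

text \<open>
  Maps with prescribed values are assembled from globally defined ones by gluing, so that no theory
  of homeomorphisms between intervals is needed.
\<close>
lemma glue_PL_homeos:
  assumes f: "f \<in> PL_homeos" and g: "g \<in> PL_homeos" and p: "p \<in> dyadic_rationals" "f p = g p"
  shows "(\<lambda>x. if x \<le> p then f x else g x) \<in> PL_homeos" (is "?h \<in> _")
proof -
  obtain f' g' where hf: "homeomorphism UNIV UNIV f f'" and hg: "homeomorphism UNIV UNIV g g'"
    using f g by (auto simp: PL_homeos_def)
  have fm: "f x < f y \<longleftrightarrow> x < y" and gm: "g x < g y \<longleftrightarrow> x < y" for x y
    using PL_homeos_strict_mono[OF f] PL_homeos_strict_mono[OF g] by (simp_all add: strict_mono_less)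
  have ff: "f' (f x) = x" "f (f' x) = x" and gg: "g' (g x) = x" "g (g' x) = x" for x
    using hf hg by (auto simp: homeomorphism_def)
  have cont: "continuous_on S f" "continuous_on S g" "continuous_on S f'" "continuous_on S g'" for S
    using hf hg by (auto simp: homeomorphism_def intro: continuous_on_subset)
  have fp: "f' (f p) = g' (f p)" using ff(1)[of p] gg(1)[of p] p by simp
  let ?h' = "\<lambda>y. if y \<le> f p then f' y else g' y"
  have hh: "?h (?h' y) = y" "?h' (?h y) = y" for y
    using fm[of p "f' y"] gm[of p "g' y"] fm[of p y] gm[of p y] p(2) ff gg by (auto simp: not_le not_less)
  have "continuous_on ({..p} \<union> {p..}) ?h"
    using p by (intro continuous_on_cases cont) auto
  moreover have "{..p} \<union> {p..} = UNIV" by auto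
  ultimately have c1: "continuous_on UNIV ?h" by simp
  have "continuous_on ({..f p} \<union> {f p..}) ?h'"
    using fp by (intro continuous_on_cases cont) auto
  moreover have "{..f p} \<union> {f p..} = UNIV" by auto
  ultimately have c2: "continuous_on UNIV ?h'" by simp
  have "homeomorphism UNIV UNIV ?h ?h'"
    by (rule homeomorphismI[OF c1 c2]) (simp, simp, rule hh(2), rule hh(1))
  moreover have "dyadic_PL ?h"
  proof -
    obtain B where B: "finite B" "B \<subseteq> dyadic_rationals"
      and BI: "\<And>I. is_interval I \<Longrightarrow> I \<inter> B = {} \<Longrightarrow> \<exists>(k::int) c. \<forall>x\<in>I. f x = 2 powi k * x + c"
      using PL_homeos_breaks[OF f] by metis
    obtain C where C: "finite C" "C \<subseteq> dyadic_rationals"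
      and CI: "\<And>I. is_interval I \<Longrightarrow> I \<inter> C = {} \<Longrightarrow> \<exists>(k::int) c. \<forall>x\<in>I. g x = 2 powi k * x + c"
      using PL_homeos_breaks[OF g] by metis
    have "\<exists>(k::int) c. \<forall>x\<in>I. ?h x = 2 powi k * x + c"
      if I: "is_interval I" "I \<inter> insert p (B \<union> C) = {}" for I
    proof -
      have "(\<forall>x\<in>I. x \<le> p) \<or> (\<forall>x\<in>I. \<not> x \<le> p)"
        using I mem_is_interval_1_I[OF I(1), of _ _ p] by (metis Int_iff emptyE insertI1 linear)
      then show ?thesis using BI[OF I(1)] CI[OF I(1)] I(2) by fastforce
    qed
    then show ?thesis
      unfolding dyadic_PL_def by (rule_tac exI[of _ "insert p (B \<union> C)"]) (use B C p in auto)
  qed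
  moreover have "?h ` dyadic_rationals = dyadic_rationals"
  proof
    have df: "f ` dyadic_rationals = dyadic_rationals" and dg: "g ` dyadic_rationals = dyadic_rationals"
      using f g by (auto simp: PL_homeos_def)
    then show "?h ` dyadic_rationals \<subseteq> dyadic_rationals" by (auto simp: image_subset_iff)
    have "?h' y \<in> dyadic_rationals" if "y \<in> dyadic_rationals" for y
      using that df dg by (metis ff(1) gg(1) imageE)
    then show "dyadic_rationals \<subseteq> ?h ` dyadic_rationals"
      by (intro subsetI image_eqI[of _ _ "?h' _"]) (rule hh(1)[symmetric])
  qed
  ultimately show ?thesis by (auto simp: PL_homeos_def)
qed

text \<open>
  Two lengths are related if intervals of these lengths can be cut into equally many pieces whose
  lengths are powers of two. Mapping the pieces onto each other in order is then a piecewise linear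
  map with slopes that are powers of two.
\<close>
inductive dyadic_equidecomposable :: "real \<Rightarrow> real \<Rightarrow> bool" where
  piece: "dyadic_equidecomposable (2 powi k) (2 powi l)"
| join: "dyadic_equidecomposable a b \<Longrightarrow> dyadic_equidecomposable a' b'
    \<Longrightarrow> dyadic_equidecomposable (a + a') (b + b')"

lemma dyadic_equidecomposable_sym:
  "dyadic_equidecomposable a b \<Longrightarrow> dyadic_equidecomposable b a"
  by (induction rule: dyadic_equidecomposable.induct) (auto intro: dyadic_equidecomposable.intros)

text \<open>
  The number of pieces on the left is adjusted by repeatedly halving the last piece.
\<close>
lemma piece_equidecomposable: "dyadic_equidecomposable (2 powi k) (real (Suc r) * 2 powi l)"
proof (induction r arbitrary: k)
  case 0
  then show ?case by (simp add: piece)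
next
  case (Suc r)
  have "(2::real) powi k = 2 powi (k - 1) + 2 powi (k - 1)" by (simp add: power_int_diff)
  moreover have "real (Suc (Suc r)) * 2 powi l = 2 powi l + real (Suc r) * 2 powi l" by (simp add: algebra_simps)
  ultimately show ?case using join[OF piece[of "k - 1" l] Suc.IH[of "k - 1"]] by simp
qed

lemma multiple_equidecomposable:
  "p \<le> q \<Longrightarrow> dyadic_equidecomposable (real (Suc p) * 2 powi k) (real (Suc q) * 2 powi l)"
proof (induction p arbitrary: q)
  case 0
  then show ?case using piece_equidecomposable by simp
next
  case (Suc p)
  then obtain q' where q': "q = Suc q'" "p \<le> q'" by (cases q) auto
  have "real (Suc (Suc p)) * 2 powi k = 2 powi k + real (Suc p) * 2 powi k"
    "real (Suc q) * 2 powi l = 2 powi l + real (Suc q') * 2 powi l" by (simp_all add: q' algebra_simps)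
  then show ?case using join[OF piece Suc.IH[OF q'(2)], of k l] by simp
qed

lemma positive_dyadic_cases:
  assumes "x \<in> dyadic_rationals" "x > 0"
  obtains p :: nat and k :: int where "x = real (Suc p) * 2 powi k"
proof -
  obtain a :: int and k :: nat where x: "x = of_int a / 2 ^ k"
    using assms by (auto simp: dyadic_rationals_def)
  then have "a > 0" using assms(2) by (simp add: zero_less_divide_iff)
  then have "x = real (Suc (nat a - 1)) * 2 powi (- int k)"
    by (simp add: x power_int_minus divide_inverse)
  then show thesis by (rule that)
qed

lemma positive_dyadics_equidecomposable:
  assumes "a \<in> dyadic_rationals" "a > 0" "b \<in> dyadic_rationals" "b > 0"
  shows "dyadic_equidecomposable a b"
proof -
  obtain p k q l where "a = real (Suc p) * 2 powi k" "b = real (Suc q) * 2 powi l"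
    using assms by (metis positive_dyadic_cases)
  then show ?thesis
    using multiple_equidecomposable[of p q k l] multiple_equidecomposable[of q p l k]
    by (cases "p \<le> q") (auto intro: dyadic_equidecomposable_sym)
qed

lemma equidecomposable_imp_PL_map:
  assumes "dyadic_equidecomposable a b" "c \<in> dyadic_rationals" "d \<in> dyadic_rationals"
  shows "\<exists>h\<in>PL_homeos. h c = d \<and> h (c + a) = d + b"
  using assms
proof (induction arbitrary: c d rule: dyadic_equidecomposable.induct)
  case (piece k l)
  let ?h = "\<lambda>x. 2 powi (l - k) * x + (d - 2 powi (l - k) * c)"
  have "?h \<in> PL_homeos"
    using piece by (intro affine_PL_homeos dyadic_diff dyadic_mult dyadic_powi)
  moreover have "?h c = d" "?h (c + 2 powi k) = d + 2 powi l"
    by (simp_all add: power_int_diff algebra_simps add_divide_distrib)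
  ultimately show ?case by (intro bexI[of _ ?h]) simp_all
next
  case (join a b a' b')
  have dy: "x \<in> dyadic_rationals" "y \<in> dyadic_rationals" "x > 0" "y > 0" if "dyadic_equidecomposable x y" for x y
    using that by (induction, auto intro: dyadic_add dyadic_powi)
  obtain f where f: "f \<in> PL_homeos" "f c = d" "f (c + a) = d + b" using join by blast
  obtain g where g: "g \<in> PL_homeos" "g (c + a) = d + b" "g (c + a + a') = d + b + b'"
    using join dy by (metis dyadic_add)
  show ?case
    by (rule bexI[OF _ glue_PL_homeos[OF f(1) g(1), of "c + a"]])
       (use f g dy(1)[OF join.hyps(1)] dy(3)[OF join.hyps(1)] dy(3)[OF join.hyps(2)] join.prems in
         \<open>auto intro: dyadic_add simp: add.assoc\<close>)
qed

text \<open>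
  Transitivity on increasing tuples, by gluing at \<open>y n\<close> a map that is correct on the last interval.
\<close>
lemma PL_map_interpolating:
  assumes "\<And>j. j \<le> n \<Longrightarrow> y j \<in> dyadic_rationals \<and> q j \<in> dyadic_rationals"
    and "\<And>j. j < n \<Longrightarrow> y j < y (Suc j) \<and> q j < q (Suc j)"
  shows "\<exists>h\<in>PL_homeos. \<forall>j\<le>n. h (y j) = q j"
  using assms
proof (induction n)
  case 0
  let ?h = "\<lambda>x. 2 powi 0 * x + (q 0 - y 0)"
  have "?h \<in> PL_homeos" using 0 by (intro affine_PL_homeos dyadic_diff) auto
  then show ?case by (rule bexI[rotated]) simp
next
  case (Suc n)
  then obtain f where f: "f \<in> PL_homeos" "\<forall>j\<le>n. f (y j) = q j" by auto
  have "dyadic_equidecomposable (y (Suc n) - y n) (q (Suc n) - q n)"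
    using Suc.prems by (intro positive_dyadics_equidecomposable dyadic_diff) auto
  from equidecomposable_imp_PL_map[OF this, of "y n" "q n"]
  obtain g where g: "g \<in> PL_homeos" "g (y n) = q n" "g (y (Suc n)) = q (Suc n)"
    using Suc.prems by auto
  have less: "y j \<le> y n" if "j \<le> n" for j
    using that Suc.prems(2) by (induction j rule: inc_induct) (auto intro: less_imp_le order_trans less_le_trans)
  show ?case
  proof (rule bexI[OF _ glue_PL_homeos[OF f(1) g(1), of "y n"]])
    show "\<forall>j\<le>Suc n. (if y j \<le> y n then f (y j) else g (y j)) = q j"
      using f g less Suc.prems(2)[of n] by (auto simp: le_Suc_eq)
  qed (use Suc.prems f g in auto)
qed

text \<open>
  Adding the fixed points \<open>a\<close> and \<open>b\<close> to the two tuples makes it possible to continue the map by the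
  identity on both sides.
\<close>
lemma PL_map_interpolating_supported:
  assumes ab: "a \<in> dyadic_rationals" "b \<in> dyadic_rationals"
    and dy: "\<And>j. j \<le> n \<Longrightarrow> y j \<in> dyadic_rationals \<inter> {a<..<b} \<and> q j \<in> dyadic_rationals \<inter> {a<..<b}"
    and mono: "\<And>j. j < n \<Longrightarrow> y j < y (Suc j) \<and> q j < q (Suc j)"
  obtains h where "h \<in> PL_homeos" "\<And>x. x \<notin> {a..b} \<Longrightarrow> h x = x" "\<And>j. j \<le> n \<Longrightarrow> h (y j) = q j"
proof -
  define ext where "ext z j = (case j of 0 \<Rightarrow> a | Suc i \<Rightarrow> if i \<le> n then z i else b)" for z and j :: nat
  have "\<exists>h\<in>PL_homeos. \<forall>j\<le>Suc (Suc n). h (ext y j) = ext q j"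
  proof (rule PL_map_interpolating)
    fix j show "ext y j \<in> dyadic_rationals \<and> ext q j \<in> dyadic_rationals"
      using ab dy by (auto simp: ext_def split: nat.split)
  next
    fix j assume "j < Suc (Suc n)"
    then show "ext y j < ext y (Suc j) \<and> ext q j < ext q (Suc j)"
      using dy mono by (cases "j = Suc n") (auto simp: ext_def split: nat.split)
  qed
  then obtain h where h: "h \<in> PL_homeos" "\<And>j. j \<le> Suc (Suc n) \<Longrightarrow> h (ext y j) = ext q j" by blast
  have ha: "h a = a" using h(2)[of 0] by (simp add: ext_def)
  have hb: "h b = b" using h(2)[of "Suc (Suc n)"] by (simp add: ext_def)
  have hy: "h (y j) = q j" if "j \<le> n" for j using h(2)[of "Suc j"] that by (simp add: ext_def)
  have lt: "a < y j" "y j < b" if "j \<le> n" for j using dy[OF that] by auto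
  have "a < b" using lt[of 0] by simp
  have id: "(\<lambda>x. x) \<in> PL_homeos"
    using affine_PL_homeos[of 0 0] dyadic_of_int[of 0] by simp
  have 1: "(\<lambda>x. if x \<le> b then h x else x) \<in> PL_homeos"
    by (rule glue_PL_homeos[OF h(1) id ab(2) hb])
  have 2: "(\<lambda>x. if x \<le> a then x else if x \<le> b then h x else x) \<in> PL_homeos"
    by (rule glue_PL_homeos[OF id 1 ab(1)]) (use ha \<open>a < b\<close> in simp)
  show thesis
  proof (rule that)
    show "(\<lambda>x. if x \<le> a then x else if x \<le> b then h x else x) \<in> PL_homeos"
      by (rule 2)
    show "(if y j \<le> a then y j else if y j \<le> b then h (y j) else y j) = q j" if "j \<le> n" for j
      using hy[OF that] lt[OF that] by simp
  qed (use ha hb in auto)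
qed

text \<open>
  The points \<open>p\<close> and \<open>p'\<close> may lie on the boundary of \<open>I\<close>, that is, they may be breakpoints.
\<close>
lemma affine_agree:
  fixes f g :: "real \<Rightarrow> real"
  assumes "continuous_on UNIV f" "continuous_on UNIV g"
    and f: "\<And>x. x \<in> I \<Longrightarrow> f x = a * x + c" and g: "\<And>x. x \<in> I \<Longrightarrow> g x = a' * x + c'"
    and p: "p \<in> closure I" "p' \<in> closure I" "p \<noteq> p'" "f p = g p" "f p' = g p'"
    and x: "x \<in> I"
  shows "f x = g x"
proof -
  have "f z - a * z = c" if "z \<in> closure I" for z
    by (rule continuous_constant_on_closure[OF _ _ that])
       (use assms(1) f in \<open>auto intro!: continuous_intros intro: continuous_on_subset\<close>)
  moreover have "g z - a' * z = c'" if "z \<in> closure I" for z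
    by (rule continuous_constant_on_closure[OF _ _ that])
       (use assms(2) g in \<open>auto intro!: continuous_intros intro: continuous_on_subset\<close>)
  ultimately have e: "a * p + c = a' * p + c'" "a * p' + c = a' * p' + c'"
    using p by (smt (verit))+
  then have "(a - a') * (p - p') = 0" by (simp add: algebra_simps)
  then have "a = a'" using p(3) by simp
  then show ?thesis using e f[OF x] g[OF x] by simp
qed

text \<open>
  A map is determined by its breakpoints, its values there, and one further value on either side of
  all of them; all these numbers are dyadic. Countability is indispensable because the support of a
  probability measure that generates the group is countable.
\<close>
lemma countable_PL_homeos: "countable PL_homeos"
proof -
  define breaks where "breaks f B \<longleftrightarrow> finite B \<and> B \<subseteq> dyadic_rationals \<and> 0 \<in> B \<and>
    (\<forall>I. is_interval I \<and> I \<inter> B = {} \<longrightarrow> (\<exists>a c. \<forall>x\<in>I. f x = a * x + c))" for f :: "real \<Rightarrow> real" and B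
  have "\<exists>B. breaks f B" if "f \<in> PL_homeos" for f
  proof -
    obtain B where B: "finite B" "B \<subseteq> dyadic_rationals"
      and BI: "\<And>I. is_interval I \<Longrightarrow> I \<inter> B = {} \<Longrightarrow> \<exists>(k::int) c. \<forall>x\<in>I. f x = 2 powi k * x + c"
      using PL_homeos_breaks[OF \<open>f \<in> PL_homeos\<close>] by metis
    \<comment> \<open>Adding 0 guarantees that there is at least one breakpoint.\<close>
    have "\<exists>a c. \<forall>x\<in>I. f x = a * x + c" if "is_interval I" "I \<inter> insert 0 B = {}" for I
      using BI[of I] that by blast
    then have "breaks f (insert 0 B)"
      unfolding breaks_def using dyadic_of_int[of 0] B by simp
    then show ?thesis by blast
  qed
  then obtain B where B: "\<And>f. f \<in> PL_homeos \<Longrightarrow> breaks f (B f)"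
    using bchoice[of PL_homeos breaks] by blast
  define N where "N C = C \<union> {Min C - 1, Max C + 1}" for C :: "real set"
  define code where "code f = (B f, (\<lambda>x. (x, f x)) ` N (B f))" for f
  let ?fin = "\<lambda>A. {C. finite C \<and> C \<subseteq> A}"
  have "code ` PL_homeos \<subseteq> ?fin dyadic_rationals \<times> ?fin (dyadic_rationals \<times> dyadic_rationals)"
  proof
    fix z assume "z \<in> code ` PL_homeos"
    then obtain f where f: "f \<in> PL_homeos" and z: "z = code f" by blast
    have Bf: "finite (B f)" "B f \<subseteq> dyadic_rationals" "B f \<noteq> {}" using B[OF f] by (auto simp: breaks_def)
    then have "Min (B f) \<in> dyadic_rationals" "Max (B f) \<in> dyadic_rationals" by (auto intro: Min_in Max_in)
    then have N: "N (B f) \<subseteq> dyadic_rationals" "finite (N (B f))"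
      using Bf dyadic_of_int[of 1] by (auto simp: N_def intro: dyadic_add dyadic_diff)
    moreover have "f ` dyadic_rationals = dyadic_rationals" using f by (simp add: PL_homeos_def)
    ultimately show "z \<in> ?fin dyadic_rationals \<times> ?fin (dyadic_rationals \<times> dyadic_rationals)"
      using Bf by (auto simp: z code_def)
  qed
  moreover have "countable (?fin dyadic_rationals \<times> ?fin (dyadic_rationals \<times> dyadic_rationals))"
    by (intro countable_SIGMA countable_Collect_finite_subset countable_dyadic_rationals)
  ultimately have "countable (code ` PL_homeos)" by (rule countable_subset)
  moreover have "inj_on code PL_homeos"
  proof (rule inj_onI, rule ext)
    fix f g x assume f: "f \<in> PL_homeos" and g: "g \<in> PL_homeos" and fg: "code f = code g"
    define C where "C = B f"
    have Cg: "B g = C" using fg by (simp add: code_def C_def)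
    have bf: "breaks f C" and bg: "breaks g C" using B[OF f] B[OF g] by (simp_all add: C_def Cg[unfolded C_def])
    have C: "finite C" "C \<noteq> {}" using bf by (auto simp: breaks_def)
    have eq: "f z = g z" if "z \<in> N C" for z
    proof -
      have "(z, f z) \<in> (\<lambda>x. (x, g x)) ` N C" using fg that by (auto simp: code_def C_def[symmetric] Cg)
      then show ?thesis by auto
    qed
    have cont: "continuous_on UNIV f" "continuous_on UNIV g"
      using f g by (auto simp: PL_homeos_def homeomorphism_def)
    have agree: "f x = g x" if I: "is_interval I" "I \<inter> C = {}" "x \<in> I"
      and p: "p \<in> closure I" "p' \<in> closure I" "p \<noteq> p'" "p \<in> N C" "p' \<in> N C" for I p p'
    proof -
      obtain a c where "\<And>x. x \<in> I \<Longrightarrow> f x = a * x + c" using bf I by (auto simp: breaks_def)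
      moreover obtain a' c' where "\<And>x. x \<in> I \<Longrightarrow> g x = a' * x + c'" using bg I unfolding breaks_def by blast
      ultimately show ?thesis using affine_agree[OF cont _ _ p(1-3) eq eq I(3)] p by blast
    qed
    consider "x \<in> C" | "x < Min C" | "Max C < x" | "x \<notin> C" "Min C < x" "x < Max C"
      using C by (metis Max_in Min_in linorder_neqE_linordered_idom)
    then show "f x = g x"
    proof cases
      case 1
      then show ?thesis using eq by (auto simp: N_def)
    next
      case 2
      show ?thesis
        by (rule agree[of "{..<Min C}" "Min C" "Min C - 1"])
           (use 2 C in \<open>auto simp: N_def is_interval_io closure_lessThan dest: Min_le[OF C(1)]\<close>)
    next
      case 3
      show ?thesis
        by (rule agree[of "{Max C<..}" "Max C" "Max C + 1"])
           (use 3 C in \<open>auto simp: N_def is_interval_oi closure_greaterThan dest: Max_ge[OF C(1)]\<close>)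
    next
      case 4
      define l where "l = Max {c \<in> C. c < x}"
      define u where "u = Min {c \<in> C. x < c}"
      have ne: "{c \<in> C. c < x} \<noteq> {}" "{c \<in> C. x < c} \<noteq> {}"
        using 4(2,3) Min_in[OF C] Max_in[OF C] by blast+
      have l: "l \<in> C" "l < x" using Max_in[OF _ ne(1)] C by (auto simp: l_def)
      have u: "u \<in> C" "x < u" using Min_in[OF _ ne(2)] C by (auto simp: u_def)
      have "c \<le> l" if "c \<in> C" "c < x" for c using that C by (auto simp: l_def)
      moreover have "u \<le> c" if "c \<in> C" "x < c" for c using that C by (auto simp: u_def)
      ultimately have "{l<..<u} \<inter> C = {}" using 4(1)
        by (auto simp: disjoint_iff) (metis linorder_neqE_linordered_idom not_le)
      then show ?thesis
        by (rule agree[of "{l<..<u}" l u, rotated]) (use l u in \<open>auto simp: N_def is_interval_oo\<close>)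
    qed
  qed
  ultimately show ?thesis by (rule countable_image_inj_on)
qed

section \<open>Counting functions with a prescribed residue of the sum\<close>

lemma card_shifted_residues:
  fixes C :: nat
  assumes C: "C > 0" and R: "R \<subseteq> {..<C}"
  shows "card {y \<in> {..<C}. (u + y) mod C \<in> R} = card R"
proof -
  have inj: "inj_on (\<lambda>y. (u + y) mod C) {..<C}"
  proof (rule inj_onI)
    fix y z assume yz: "y \<in> {..<C}" "z \<in> {..<C}" "(u + y) mod C = (u + z) mod C"
    have *: "a = b" if "a \<le> b" "b < C" "(u + b) mod C = (u + a) mod C" for a b
    proof -
      have "C dvd b - a" using that mod_eq_dvd_iff_nat[of "u + a" "u + b" C] by simp
      then show ?thesis using that by (auto dest: dvd_imp_le)
    qed
    show "y = z"
      using *[of y z] *[of z y, symmetric] yz by (metis lessThan_iff nat_le_linear)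
  qed
  have surj: "(\<lambda>y. (u + y) mod C) ` {..<C} = {..<C}"
    by (rule card_subset_eq) (use C card_image[OF inj] in auto)
  have "bij_betw (\<lambda>y. (u + y) mod C) {y \<in> {..<C}. (u + y) mod C \<in> R} R"
  proof (rule bij_betw_imageI)
    show "inj_on (\<lambda>y. (u + y) mod C) {y \<in> {..<C}. (u + y) mod C \<in> R}"
      by (rule inj_on_subset[OF inj]) auto
    have "R \<subseteq> (\<lambda>y. (u + y) mod C) ` {..<C}" using R by (simp only: surj)
    then show "(\<lambda>y. (u + y) mod C) ` {y \<in> {..<C}. (u + y) mod C \<in> R} = R" by (rule_tac subset_antisym) fastforce+
  qed
  then show ?thesis by (rule bij_betw_same_card)
qed

text \<open>
  Whatever the values on \<open>J\<close> are, the value at \<open>j\<close> can be chosen in exactly \<open>card R\<close> ways.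
\<close>
lemma card_residue_class_PiE:
  fixes C :: nat
  assumes C: "C > 0" and R: "R \<subseteq> {..<C}" and J: "finite J" "j \<notin> J"
  shows "card {s \<in> insert j J \<rightarrow>\<^sub>E {..<C}. (u + (\<Sum>i\<in>insert j J. s i)) mod C \<in> R} = card R * C ^ card J"
proof -
  define good where "good g = {y \<in> {..<C}. (u + (\<Sum>i\<in>J. g i) + y) mod C \<in> R}" for g :: "'a \<Rightarrow> nat"
  have fin: "finite (J \<rightarrow>\<^sub>E {..<C})" by (rule finite_PiE) (use J in auto)
  have sum_upd: "(\<Sum>i\<in>insert j J. (g(j := y)) i) = (\<Sum>i\<in>J. g i) + y" for g y
  proof -
    have "(\<Sum>i\<in>J. (g(j := y)) i) = (\<Sum>i\<in>J. g i)" by (rule sum.cong) (use J in auto)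
    then show ?thesis using J by (simp add: add.commute)
  qed
  have "{s \<in> insert j J \<rightarrow>\<^sub>E {..<C}. (u + (\<Sum>i\<in>insert j J. s i)) mod C \<in> R}
      = (\<lambda>(g, y). g(j := y)) ` (SIGMA g:J \<rightarrow>\<^sub>E {..<C}. good g)" (is "?L = ?h ` ?S")
  proof
    show "?L \<subseteq> ?h ` ?S"
    proof
      fix s assume s: "s \<in> ?L"
      then obtain g y where gy: "g \<in> J \<rightarrow>\<^sub>E {..<C}" "y \<in> {..<C}" "s = g(j := y)"
        unfolding PiE_insert_eq by auto
      then have "(g, y) \<in> ?S" using s sum_upd[of g y] by (auto simp: good_def add.assoc)
      then show "s \<in> ?h ` ?S" using gy(3) by force
    qed
    show "?h ` ?S \<subseteq> ?L"
    proof
      fix s assume "s \<in> ?h ` ?S"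
      then obtain g y where gy: "g \<in> J \<rightarrow>\<^sub>E {..<C}" "y \<in> good g" "s = g(j := y)" by auto
      then have "s \<in> insert j J \<rightarrow>\<^sub>E {..<C}" unfolding PiE_insert_eq by (force simp: good_def)
      then show "s \<in> ?L" using gy sum_upd[of g y] by (auto simp: good_def add.assoc)
    qed
  qed
  moreover have "inj_on ?h ?S"
  proof (rule inj_onI, clarify)
    fix g y g' y' assume g: "g \<in> J \<rightarrow>\<^sub>E {..<C}" "g' \<in> J \<rightarrow>\<^sub>E {..<C}" and eq: "g(j := y) = g'(j := y')"
    have "g i = g' i" for i
      using fun_cong[OF eq, of i] g J(2) by (cases "i = j") (auto simp: PiE_def extensional_def)
    then show "g = g' \<and> y = y'" using fun_cong[OF eq, of j] by auto
  qed
  ultimately have "card {s \<in> insert j J \<rightarrow>\<^sub>E {..<C}. (u + (\<Sum>i\<in>insert j J. s i)) mod C \<in> R} = card ?S"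
    by (simp add: card_image)
  also have "\<dots> = (\<Sum>g\<in>J \<rightarrow>\<^sub>E {..<C}. card (good g))"
    using fin by (subst card_SigmaI) (auto simp: good_def)
  also have "\<dots> = (\<Sum>g\<in>J \<rightarrow>\<^sub>E {..<C}. card R)"
    unfolding good_def using card_shifted_residues[OF C R] by simp
  also have "\<dots> = card R * C ^ card J" using J by (simp add: card_PiE)
  finally show ?thesis .
qed

text \<open>
  The count does not depend on the prescribed values or on their positions, as long as at least one
  coordinate stays free.
\<close>
lemma card_residue_class_fixed_coordinates:
  fixes C :: nat
  assumes C: "C > 0" and R: "R \<subseteq> {..<C}" and J: "finite J" "I \<subset> J"
    and v: "\<And>i. i \<in> I \<Longrightarrow> v i < C"
  shows "card {s \<in> J \<rightarrow>\<^sub>E {..<C}. (\<forall>i\<in>I. s i = v i) \<and> (\<Sum>i\<in>J. s i) mod C \<in> R}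
    = card R * C ^ (card J - card I - 1)"
proof -
  obtain j where j: "j \<in> J" "j \<notin> I" using psubset_imp_ex_mem[OF J(2)] by auto
  define J' where "J' = J - I - {j}"
  have JI: "J - I = insert j J'" "finite J'" "j \<notin> J'" using j J by (auto simp: J'_def)
  have cardJ': "card J' = card J - card I - 1"
  proof -
    have "finite I" using J by (auto intro: finite_subset)
    then show ?thesis using J j by (simp add: J'_def card_Diff_subset)
  qed
  have split: "(\<Sum>i\<in>J. s i) = (\<Sum>i\<in>I. s i) + (\<Sum>i\<in>J - I. s i)" for s :: "'a \<Rightarrow> nat"
    using sum.subset_diff[of I J s] J by (simp add: add.commute)
  define A where "A = {s \<in> J \<rightarrow>\<^sub>E {..<C}. (\<forall>i\<in>I. s i = v i) \<and> (\<Sum>i\<in>J. s i) mod C \<in> R}"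
  define B where "B = {s \<in> insert j J' \<rightarrow>\<^sub>E {..<C}. ((\<Sum>i\<in>I. v i) + (\<Sum>i\<in>insert j J'. s i)) mod C \<in> R}"
  have "bij_betw (\<lambda>s. restrict s (J - I)) A B"
  proof (rule bij_betw_byWitness[where f' = "\<lambda>s i. if i \<in> I then v i else s i"])
    show "\<forall>s\<in>A. (\<lambda>i. if i \<in> I then v i else restrict s (J - I) i) = s"
      by (auto simp: A_def fun_eq_iff PiE_def extensional_def)
    show "\<forall>s\<in>B. restrict (\<lambda>i. if i \<in> I then v i else s i) (J - I) = s"
      unfolding B_def JI(1)[symmetric] by (auto simp: fun_eq_iff PiE_def extensional_def)
    show "(\<lambda>s. restrict s (J - I)) ` A \<subseteq> B"
    proof (rule image_subsetI)
      fix s assume "s \<in> A"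
      then have s: "s \<in> J \<rightarrow>\<^sub>E {..<C}" "\<And>i. i \<in> I \<Longrightarrow> s i = v i" "(\<Sum>i\<in>J. s i) mod C \<in> R"
        by (auto simp: A_def)
      have "(\<Sum>i\<in>I. v i) = (\<Sum>i\<in>I. s i)" using s(2) by (intro sum.cong) auto
      moreover have "(\<Sum>i\<in>J - I. restrict s (J - I) i) = (\<Sum>i\<in>J - I. s i)" by (rule sum.cong) auto
      ultimately have "(\<Sum>i\<in>I. v i) + (\<Sum>i\<in>J - I. restrict s (J - I) i) = (\<Sum>i\<in>J. s i)"
        by (simp only: split)
      moreover have "restrict s (J - I) \<in> J - I \<rightarrow>\<^sub>E {..<C}" using s(1) by (auto simp: PiE_iff)
      ultimately show "restrict s (J - I) \<in> B"
        unfolding B_def JI(1)[symmetric] using s(3) by (simp only: mem_Collect_eq simp_thms)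
    qed
    show "(\<lambda>s i. if i \<in> I then v i else s i) ` B \<subseteq> A"
    proof (rule image_subsetI)
      fix s assume "s \<in> B"
      then have s: "s \<in> J - I \<rightarrow>\<^sub>E {..<C}" "((\<Sum>i\<in>I. v i) + (\<Sum>i\<in>J - I. s i)) mod C \<in> R"
        unfolding B_def JI(1)[symmetric] by auto
      let ?s = "\<lambda>i. if i \<in> I then v i else s i"
      have "(\<Sum>i\<in>I. ?s i) = (\<Sum>i\<in>I. v i)" "(\<Sum>i\<in>J - I. ?s i) = (\<Sum>i\<in>J - I. s i)"
        by (auto intro: sum.cong)
      then have "(\<Sum>i\<in>J. ?s i) mod C \<in> R" using s(2) by (simp only: split)
      moreover have "?s \<in> J \<rightarrow>\<^sub>E {..<C}"
        using s(1) v J by (auto simp: PiE_iff extensional_def)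
      ultimately show "?s \<in> A" by (simp add: A_def)
    qed
  qed
  then have "card A = card B" by (rule bij_betw_same_card)
  also have "\<dots> = card R * C ^ card J'"
    unfolding B_def by (rule card_residue_class_PiE[OF C R JI(2,3)])
  finally show ?thesis by (simp add: A_def cardJ')
qed

text \<open>
  The larger exponents agree, because two powers with exponents below \<open>c\<close> add up to less than \<open>3 ^ c\<close>.
\<close>
lemma power3_sum_determines_summands:
  fixes a b c d :: nat
  assumes eq: "(3::nat) ^ a + 3 ^ d = 3 ^ c + 3 ^ b"
  shows "a = c \<and> d = b \<or> a = b \<and> d = c"
proof -
  have ordered: "a = c \<and> d = b" if eq: "(3::nat) ^ a + 3 ^ d = 3 ^ c + 3 ^ b" and "d \<le> a" "b \<le> c" for a b c d :: nat
  proof -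
    have not_less: "\<not> a < c" if eq: "(3::nat) ^ a + 3 ^ d = 3 ^ c + 3 ^ b" and "d \<le> a" for a b c d :: nat
    proof
      assume "a < c"
      then have "(3::nat) ^ Suc a \<le> 3 ^ c" by (intro power_increasing) auto
      moreover have "(3::nat) ^ d \<le> 3 ^ a" using \<open>d \<le> a\<close> by (intro power_increasing) auto
      moreover have "(0::nat) < 3 ^ a" by simp
      ultimately show False using eq by simp
    qed
    have "a = c" using not_less[OF eq] not_less[OF eq[symmetric]] that by linarith
    then show ?thesis using eq by simp
  qed
  have sym: "(3::nat) ^ d + 3 ^ a = 3 ^ c + 3 ^ b" "(3::nat) ^ a + 3 ^ d = 3 ^ b + 3 ^ c"
    "(3::nat) ^ d + 3 ^ a = 3 ^ b + 3 ^ c"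
    using eq by (simp_all only: add.commute)
  show ?thesis
    using ordered[OF eq] ordered[OF sym(1)] ordered[OF sym(2)] ordered[OF sym(3)] by linarith
qed

section \<open>From multisets of tuples to sets of tuples\<close>

lemma sum_const_mset: "finite A \<Longrightarrow> (\<Sum>a\<in>A. M) = repeat_mset (card A) (M :: 'a multiset)"
  by (induction A rule: finite_induct) auto

lemma size_sum_msets: "finite A \<Longrightarrow> size (\<Sum>a\<in>A. M a) = (\<Sum>a\<in>A. size (M a :: 'a multiset))"
  by (induction A rule: finite_induct) auto

lemma image_mset_eq_sum:
  "image_mset f M = (\<Sum>x\<in>set_mset M. repeat_mset (count M x) {#f x#})"
  by (rule multiset_eqI)
     (auto simp: count_image_mset' count_sum sum.inter_filter[symmetric] intro!: sum.cong)

lemma image_mset_mset_set_eq_sum: "finite A \<Longrightarrow> image_mset f (mset_set A) = (\<Sum>a\<in>A. {#f a#})"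
  by (induction A rule: finite_induct) auto

text \<open>
  The pair entering \<^const>\<open>block_sums\<close> for a single tuple. When \<open>x\<close> lists the distances between
  successive points numbered \<open>0, \<dots>, n\<close>, it consists of the distances from point \<open>i - 1\<close> to point \<open>k\<close>
  and from point \<open>k\<close> to point \<open>m\<close>.
\<close>
definition block_pair :: "nat \<Rightarrow> nat \<Rightarrow> nat \<Rightarrow> (nat \<Rightarrow> nat) \<Rightarrow> nat \<times> nat" where
  "block_pair i k m x = (\<Sum>j=i..k. x j, \<Sum>j=k+1..m. x j)"

lemma block_sums_eq: "block_sums W i k m = image_mset (block_pair i k m) (mset_set W)"
  by (simp add: block_sums_def block_pair_def[abs_def])

context
  fixes n :: nat and T :: "(nat \<Rightarrow> nat) multiset"
  assumes n: "n \<ge> 3" and T: "set_mset T \<subseteq> {1..n} \<rightarrow>\<^sub>E {1..}" "T \<noteq> {#}"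
begin

definition period :: nat where "period = (n + 1) * size T"

text \<open>
  There are as many residues as the multiplicity of \<open>x\<close> demands, and all of them are 1 modulo
  \<open>n + 1\<close>. A constant marking has a sum divisible by \<open>n + 1\<close> and is therefore
  excluded. This matters because two constant markings would displace all points by the same amount
  and lead to equal distances.
\<close>
definition residues_of :: "(nat \<Rightarrow> nat) \<Rightarrow> nat set" where
  "residues_of x = (\<lambda>r. (n + 1) * r + 1) ` {..<count T x}"

definition markings :: "(nat \<Rightarrow> nat) \<Rightarrow> (nat \<Rightarrow> nat) set" where
  "markings x = {s \<in> {..n} \<rightarrow>\<^sub>E {..<period}. (\<Sum>j\<in>{..n}. s j) mod period \<in> residues_of x}"

text \<open>
  The distances after the tuple is stretched by \<open>2 * 3 ^ period\<close> and the point with index \<open>j\<close> is moved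
  by \<open>3 ^ s j\<close>. Since all displacements are less than \<open>3 ^ period\<close>, the stretching factor keeps
  different tuples apart and the distances positive.
\<close>
definition perturb :: "(nat \<Rightarrow> nat) \<Rightarrow> (nat \<Rightarrow> nat) \<Rightarrow> nat \<Rightarrow> nat" where
  "perturb x s = (\<lambda>j\<in>{1..n}. 2 * 3 ^ period * x j + 3 ^ s j - 3 ^ s (j - 1))"

definition marked_tuples :: "((nat \<Rightarrow> nat) \<times> (nat \<Rightarrow> nat)) set" where
  "marked_tuples = Sigma (set_mset T) markings"

definition spread :: "(nat \<Rightarrow> nat) set" where
  "spread = (\<lambda>(x, s). perturb x s) ` marked_tuples"

text \<open>
  The effect of the perturbation on a pair of distances depends only on the marks of the three points
  involved.
\<close>
definition perturb_pair :: "nat \<times> nat \<times> nat \<Rightarrow> nat \<times> nat \<Rightarrow> nat \<times> nat" where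
  "perturb_pair = (\<lambda>(a, b, c) (u, v). (2 * 3 ^ period * u + 3 ^ b - 3 ^ a, 2 * 3 ^ period * v + 3 ^ c - 3 ^ b))"

lemma period_pos: "period > 0"
  using T(2) by (simp add: period_def nonempty_has_size)

lemma card_residues_of: "card (residues_of x) = count T x"
proof -
  have "inj_on (\<lambda>r. (n + 1) * r + 1) {..<count T x}"
  proof (rule inj_onI)
    fix r r' assume "(n + 1) * r + 1 = (n + 1) * r' + 1"
    then have "(n + 1) * r = (n + 1) * r'" by (simp only: add_right_cancel)
    then show "r = r'" by (simp only: mult_cancel1) simp
  qed
  then show ?thesis unfolding residues_of_def by (simp only: card_image card_lessThan)
qed

lemma residues_of_subset: "residues_of x \<subseteq> {..<period}"
proof
  fix q assume "q \<in> residues_of x"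
  then obtain r where r: "q = (n + 1) * r + 1" "r < count T x" by (auto simp: residues_of_def)
  then have "Suc r \<le> size T" using count_le_size[of T x] by linarith
  then have "(n + 1) * Suc r \<le> period" unfolding period_def by (rule mult_le_mono2)
  then show "q \<in> {..<period}" using r n by simp
qed

lemma finite_markings: "finite (markings x)"
proof -
  have "finite ({..n} \<rightarrow>\<^sub>E {..<period})" by (rule finite_PiE) auto
  then show ?thesis by (simp add: markings_def)
qed

lemma finite_marked_tuples: "finite marked_tuples"
  by (simp add: marked_tuples_def finite_markings)

lemma card_markings: "card (markings x) = count T x * period ^ n"
  unfolding markings_def
  using card_residue_class_fixed_coordinates[OF period_pos residues_of_subset, of "{..n}" "{}" "\<lambda>_. 0" x]
  by (auto simp: card_residues_of)

lemma card_markings_fixed: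
  assumes "i < k" "k < m" "m \<le> n" "a < period" "b < period" "c < period"
  shows "card {s \<in> markings x. (s i, s k, s m) = (a, b, c)} = count T x * period ^ (n - 3)"
proof -
  define v where "v j = (if j = i then a else if j = k then b else c)" for j
  have eq: "{s \<in> markings x. (s i, s k, s m) = (a, b, c)}
    = {s \<in> {..n} \<rightarrow>\<^sub>E {..<period}. (\<forall>j\<in>{i, k, m}. s j = v j) \<and> (\<Sum>j\<in>{..n}. s j) mod period \<in> residues_of x}"
    using assms by (auto simp: markings_def v_def)
  have sub: "{i, k, m} \<subset> {..n}"
  proof
    show "{i, k, m} \<noteq> {..n}"
    proof
      assume "{i, k, m} = {..n}"
      moreover have "card {i, k, m} \<le> 3" by (simp add: card_insert_if)
      ultimately have "card {..n} \<le> 3" by simp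
      then show False using n by simp
    qed
  qed (use assms in auto)
  moreover from sub have "card {s \<in> {..n} \<rightarrow>\<^sub>E {..<period}. (\<forall>j\<in>{i, k, m}. s j = v j) \<and> (\<Sum>j\<in>{..n}. s j) mod period \<in> residues_of x}
    = card (residues_of x) * period ^ (card {..n} - card {i, k, m} - 1)"
    by (intro card_residue_class_fixed_coordinates period_pos residues_of_subset finite_atMost)
       (use assms in \<open>auto simp: v_def\<close>)
  moreover have "card {..n} - card {i, k, m} - 1 = n - 3" using assms by simp
  ultimately show ?thesis by (simp only: eq card_residues_of)
qed

lemma perturb_step:
  assumes x: "x \<in># T" and s: "s \<in> markings x" and j: "1 \<le> j" "j \<le> n"
  shows "perturb x s j + 3 ^ s (j - 1) = 2 * 3 ^ period * x j + 3 ^ s j"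
    and "perturb x s j \<ge> 1"
proof -
  have "x j \<ge> 1" using x T(1) j by (force simp: PiE_iff)
  then have L: "2 * 3 ^ period \<le> 2 * 3 ^ period * x j" by simp
  have "s (j - 1) < period" using s j by (force simp: markings_def PiE_iff)
  then have small: "(3::nat) ^ s (j - 1) < 3 ^ period" by simp
  have eq: "perturb x s j = 2 * 3 ^ period * x j + 3 ^ s j - 3 ^ s (j - 1)" using j by (simp add: perturb_def)
  show "perturb x s j + 3 ^ s (j - 1) = 2 * 3 ^ period * x j + 3 ^ s j"
    using eq L small by linarith
  show "perturb x s j \<ge> 1" using eq L small by linarith
qed

lemma perturb_block:
  assumes x: "x \<in># T" and s: "s \<in> markings x" and i: "1 \<le> i" "i \<le> k" "k \<le> n"
  shows "(\<Sum>j=i..k. perturb x s j) + 3 ^ s (i - 1) = 2 * 3 ^ period * (\<Sum>j=i..k. x j) + 3 ^ s k"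
  using i(2,3)
proof (induction k rule: dec_induct)
  case base
  then show ?case using perturb_step(1)[OF x s, of i] i by simp
next
  case (step k)
  then show ?case using perturb_step(1)[OF x s, of "Suc k"] i(1) by (simp add: algebra_simps)
qed

lemma block_pair_perturb:
  assumes "x \<in># T" "s \<in> markings x" "1 \<le> i" "i \<le> k" "k < m" "m \<le> n"
  shows "block_pair i k m (perturb x s) = perturb_pair (s (i - 1), s k, s m) (block_pair i k m x)"
proof -
  have "(\<Sum>j=i..k. perturb x s j) = 2 * 3 ^ period * (\<Sum>j=i..k. x j) + 3 ^ s k - 3 ^ s (i - 1)"
    by (rule add_implies_diff, rule perturb_block) (use assms in auto)
  moreover have "(\<Sum>j=k+1..m. perturb x s j) + 3 ^ s (k + 1 - 1) = 2 * 3 ^ period * (\<Sum>j=k+1..m. x j) + 3 ^ s m"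
    by (rule perturb_block) (use assms in auto)
  then have "(\<Sum>j=k+1..m. perturb x s j) = 2 * 3 ^ period * (\<Sum>j=k+1..m. x j) + 3 ^ s m - 3 ^ s k"
    by (intro add_implies_diff) simp
  ultimately show ?thesis by (simp only: block_pair_def perturb_pair_def prod.case)
qed

lemma marking_not_constant:
  assumes s: "s \<in> markings x"
  shows "\<exists>j\<le>n. s j \<noteq> s 0"
proof (rule ccontr)
  assume "\<not> (\<exists>j\<le>n. s j \<noteq> s 0)"
  then have const: "s j = s 0" if "j \<le> n" for j using that by blast
  have "(\<Sum>j\<in>{..n}. s j) = (\<Sum>j\<in>{..n}. s 0)"
    by (rule sum.cong[OF refl], rule const) simp
  then have "(\<Sum>j\<in>{..n}. s j) mod period = (n + 1) * s 0 mod ((n + 1) * size T)"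
    by (simp only: period_def sum_constant card_atMost of_nat_id Suc_eq_plus1)
  also have "\<dots> = (n + 1) * (s 0 mod size T)" by (simp only: mult_mod_right)
  finally have "(n + 1) * (s 0 mod size T) \<in> residues_of x" using s by (simp only: markings_def mem_Collect_eq)
  then obtain r where "(n + 1) * (s 0 mod size T) = (n + 1) * r + 1" unfolding residues_of_def by blast
  then have "((n + 1) * r + 1) mod (n + 1) = ((n + 1) * (s 0 mod size T)) mod (n + 1)" by (simp only:)
  then have "1 mod (n + 1) = 0" by (simp only: mod_mult_self4 mod_mult_self1_is_0)
  then show False using n by (simp only: mod_less)
qed

text \<open>
  The stretching factor makes \<open>x\<close> recoverable, and then the displacements are known up to a common
  translation. A translation by a nonzero amount determines the power of 3 it starts from, so it can
  only match constant markings, and these do not occur.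
\<close>
lemma inj_on_perturb: "inj_on (\<lambda>(x, s). perturb x s) marked_tuples"
proof (rule inj_onI, clarify)
  fix x s x' s' assume P: "(x, s) \<in> marked_tuples" "(x', s') \<in> marked_tuples" and eq: "perturb x s = perturb x' s'"
  then have x: "x \<in># T" "s \<in> markings x" and x': "x' \<in># T" "s' \<in> markings x'"
    by (auto simp: marked_tuples_def)
  have small: "(3::nat) ^ s j < 3 ^ period" "(3::nat) ^ s' j < 3 ^ period" if "j \<le> n" for j
    using x(2) x'(2) that by (auto simp: markings_def PiE_iff)
  have xx: "x j = x' j" if j: "1 \<le> j" "j \<le> n" for j
  proof -
    have e: "2 * 3 ^ period * x j + 3 ^ s j + 3 ^ s' (j - 1) = 2 * 3 ^ period * x' j + 3 ^ s' j + 3 ^ s (j - 1)"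
      using perturb_step(1)[OF x j] perturb_step(1)[OF x' j] eq by simp
    \<comment> \<open>Both sides of the equation are multiples of the stretching factor plus a smaller remainder.\<close>
    have no: "\<not> a < b" if "2 * 3 ^ period * a + u = 2 * 3 ^ period * b + v" "u < 2 * 3 ^ period"
      for a b u v :: nat
    proof
      assume "a < b"
      then have "2 * 3 ^ period * Suc a \<le> 2 * 3 ^ period * b" by (intro mult_le_mono2) simp
      then show False using that by simp
    qed
    have "3 ^ s j + 3 ^ s' (j - 1) < (2 * 3 ^ period :: nat)" "3 ^ s' j + 3 ^ s (j - 1) < (2 * 3 ^ period :: nat)"
      using small[of j] small[of "j - 1"] j by linarith+
    then have "\<not> x j < x' j" "\<not> x' j < x j"
      using e by (intro no[of _ "3 ^ s j + 3 ^ s' (j - 1)" _ "3 ^ s' j + 3 ^ s (j - 1)"]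
          no[of _ "3 ^ s' j + 3 ^ s (j - 1)" _ "3 ^ s j + 3 ^ s' (j - 1)"]; simp only: add.assoc)+
    then show ?thesis by simp
  qed
  have "x = x'"
    by (rule PiE_ext[of _ "{1..n}" "\<lambda>_. {1..}"]) (use x x' T xx in auto)
  have step: "(3::nat) ^ s (Suc j) + 3 ^ s' j = 3 ^ s' (Suc j) + 3 ^ s j" if "Suc j \<le> n" for j
    using perturb_step(1)[OF x, of "Suc j"] perturb_step(1)[OF x', of "Suc j"] eq that xx[of "Suc j"] by simp
  have all: "(3::nat) ^ s j + 3 ^ s' 0 = 3 ^ s' j + 3 ^ s 0" if "j \<le> n" for j
    using that
  proof (induction j)
    case (Suc j)
    then show ?case using step[of j] by simp
  qed simp
  obtain j where j: "j \<le> n" "s j \<noteq> s 0" using marking_not_constant[OF x(2)] by blast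
  have s0: "s 0 = s' 0" using power3_sum_determines_summands[OF all[OF j(1)]] j(2) by auto
  have "s j = s' j" if "j \<le> n" for j using all[OF that] s0 by simp
  then have "s = s'"
    using x(2) x'(2) by (intro PiE_ext[of s "{..n}" "\<lambda>_. {..<period}" s']) (auto simp: markings_def)
  with \<open>x = x'\<close> show "x = x' \<and> s = s'" by simp
qed

lemma card_spread: "card spread = period ^ n * size T"
proof -
  have "card spread = card marked_tuples"
    unfolding spread_def by (rule card_image[OF inj_on_perturb])
  also have "\<dots> = (\<Sum>x\<in>set_mset T. count T x * period ^ n)"
    unfolding marked_tuples_def by (subst card_SigmaI) (auto simp: finite_markings card_markings)
  also have "\<dots> = period ^ n * size T"
    by (simp add: sum_distrib_right[symmetric] size_multiset_overloaded_eq)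
  finally show ?thesis .
qed

text \<open>
  Grouping the marked tuples by the three marks \<open>t\<close> at the points of the triple: each \<open>t\<close> comes from
  \<open>period ^ (n - 3) * count T x\<close> of the markings of \<open>x\<close>. The right-hand side
  depends on the triple only through the image of \<open>T\<close>, by the same operation for all triples.
\<close>
lemma block_sums_spread:
  assumes i: "1 \<le> i" "i \<le> k" "k < m" "m \<le> n"
  shows "block_sums spread i k m
    = (\<Sum>t\<in>{..<period} \<times> {..<period} \<times> {..<period}. repeat_mset (period ^ (n - 3))
        (image_mset (perturb_pair t) (image_mset (block_pair i k m) T)))"
proof -
  let ?Q = "{..<period} \<times> {..<period} \<times> {..<period}"
  let ?key = "\<lambda>s :: nat \<Rightarrow> nat. (s (i - 1), s k, s m)"
  have "block_sums spread i k m = image_mset (\<lambda>p. block_pair i k m (case p of (x, s) \<Rightarrow> perturb x s)) (mset_set marked_tuples)"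
    unfolding block_sums_eq spread_def
    by (simp add: image_mset_mset_set[OF inj_on_perturb, symmetric] multiset.map_comp o_def)
  also have "\<dots> = (\<Sum>p\<in>marked_tuples. {#block_pair i k m (case p of (x, s) \<Rightarrow> perturb x s)#})"
    by (rule image_mset_mset_set_eq_sum[OF finite_marked_tuples])
  also have "\<dots> = (\<Sum>x\<in>set_mset T. \<Sum>s\<in>markings x. {#block_pair i k m (perturb x s)#})"
    unfolding marked_tuples_def by (subst sum.Sigma) (simp_all add: finite_markings case_prod_unfold)
  also have "\<dots> = (\<Sum>x\<in>set_mset T. \<Sum>t\<in>?Q. repeat_mset (period ^ (n - 3)) (repeat_mset (count T x) {#perturb_pair t (block_pair i k m x)#}))"
  proof (rule sum.cong[OF refl])
    fix x assume x: "x \<in> set_mset T"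
    have key: "?key ` markings x \<subseteq> ?Q" using i by (auto simp: markings_def PiE_iff)
    have "(\<Sum>s\<in>markings x. {#block_pair i k m (perturb x s)#})
        = (\<Sum>s\<in>markings x. {#perturb_pair (?key s) (block_pair i k m x)#})"
      by (rule sum.cong) (use block_pair_perturb[OF _ _ i] x in auto)
    also have "\<dots> = (\<Sum>t\<in>?Q. \<Sum>s\<in>{s \<in> markings x. ?key s = t}. {#perturb_pair (?key s) (block_pair i k m x)#})"
      by (rule sum.group[OF finite_markings _ key, symmetric]) simp
    also have "\<dots> = (\<Sum>t\<in>?Q. repeat_mset (period ^ (n - 3)) (repeat_mset (count T x) {#perturb_pair t (block_pair i k m x)#}))"
    proof (rule sum.cong[OF refl])
      fix t assume t: "t \<in> ?Q"
      obtain a b c where abc: "t = (a, b, c)" by (cases t)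
      have "(\<Sum>s\<in>{s \<in> markings x. ?key s = t}. {#perturb_pair (?key s) (block_pair i k m x)#})
          = (\<Sum>s\<in>{s \<in> markings x. ?key s = t}. {#perturb_pair t (block_pair i k m x)#})"
        by (rule sum.cong) auto
      also have "\<dots> = repeat_mset (card {s \<in> markings x. ?key s = t}) {#perturb_pair t (block_pair i k m x)#}"
        by (rule sum_const_mset) (use finite_markings in auto)
      also have "card {s \<in> markings x. ?key s = t} = count T x * period ^ (n - 3)"
        unfolding abc by (rule card_markings_fixed) (use i t abc in auto)
      finally show "(\<Sum>s\<in>{s \<in> markings x. ?key s = t}. {#perturb_pair (?key s) (block_pair i k m x)#})
        = repeat_mset (period ^ (n - 3)) (repeat_mset (count T x) {#perturb_pair t (block_pair i k m x)#})"
        by (simp only: repeat_mset_right mult.commute)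
    qed
    finally show "(\<Sum>s\<in>markings x. {#block_pair i k m (perturb x s)#})
      = (\<Sum>t\<in>?Q. repeat_mset (period ^ (n - 3)) (repeat_mset (count T x) {#perturb_pair t (block_pair i k m x)#}))" .
  qed
  also have "\<dots> = (\<Sum>t\<in>?Q. \<Sum>x\<in>set_mset T. repeat_mset (period ^ (n - 3)) (repeat_mset (count T x) {#perturb_pair t (block_pair i k m x)#}))"
    by (rule sum.swap)
  also have "\<dots> = (\<Sum>t\<in>?Q. repeat_mset (period ^ (n - 3)) (image_mset (perturb_pair t) (image_mset (block_pair i k m) T)))"
  proof (rule sum.cong[OF refl])
    fix t
    have dist: "(\<Sum>x\<in>A. repeat_mset c (M x)) = repeat_mset c (\<Sum>x\<in>A. M x)" for c A and M :: "(nat \<Rightarrow> nat) \<Rightarrow> (nat \<times> nat) multiset"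
      by (rule multiset_eqI) (simp add: count_sum sum_distrib_left)
    show "(\<Sum>x\<in>set_mset T. repeat_mset (period ^ (n - 3)) (repeat_mset (count T x) {#perturb_pair t (block_pair i k m x)#}))
      = repeat_mset (period ^ (n - 3)) (image_mset (perturb_pair t) (image_mset (block_pair i k m) T))"
      unfolding dist multiset.map_comp
      unfolding image_mset_eq_sum[of "perturb_pair t \<circ> block_pair i k m" T] o_apply ..
  qed
  finally show ?thesis .
qed

text \<open>
  The operation in \<open>block_sums_spread\<close> is monotone, so that it carries a common part of the multisets
  for \<open>T\<close> to a common part of those for the spread set, and it multiplies all sizes by
  \<open>period ^ n\<close>.
\<close>
lemma spread_common_part:
  assumes K: "\<And>i k m. 1 \<le> i \<Longrightarrow> i \<le> k \<Longrightarrow> k < m \<Longrightarrow> m \<le> n \<Longrightarrow> K \<subseteq># image_mset (block_pair i k m) T"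
  shows "period ^ n * size K \<le> size (block_sums_inter spread n)"
proof -
  let ?Q = "{..<period} \<times> {..<period} \<times> {..<period}"
  define K' where "K' = (\<Sum>t\<in>?Q. repeat_mset (period ^ (n - 3)) (image_mset (perturb_pair t) K))"
  have "K' \<subseteq># block_sums spread i k m" if i: "1 \<le> i" "i \<le> k" "k < m" "m \<le> n" for i k m
    unfolding K'_def block_sums_spread[OF i]
  proof (rule mset_subset_eqI)
    fix z
    have "count (image_mset (perturb_pair t) K) z
        \<le> count (image_mset (perturb_pair t) (image_mset (block_pair i k m) T)) z" for t
      by (rule mset_subset_eq_count[OF image_mset_subseteq_mono[OF K[OF i]]])
    then show "count (\<Sum>t\<in>?Q. repeat_mset (period ^ (n - 3)) (image_mset (perturb_pair t) K)) z
        \<le> count (\<Sum>t\<in>?Q. repeat_mset (period ^ (n - 3))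
          (image_mset (perturb_pair t) (image_mset (block_pair i k m) T))) z"
      by (simp only: count_sum count_repeat_mset) (intro sum_mono mult_le_mono2)
  qed
  moreover have "\<exists>i k m :: nat. 1 \<le> i \<and> i \<le> k \<and> k < m \<and> m \<le> n"
    by (rule exI[of _ 1], rule exI[of _ 1], rule exI[of _ 2]) (use n in simp)
  ultimately have "K' \<subseteq># block_sums_inter spread n"
    unfolding block_sums_inter_def by (intro subset_mset.cInf_greatest) blast+
  then have "size K' \<le> size (block_sums_inter spread n)" by (rule size_mset_mono)
  moreover have "size K' = period ^ 3 * period ^ (n - 3) * size K"
    unfolding K'_def by (subst size_sum_msets) (simp_all add: card_cartesian_product power3_eq_cube)
  moreover have "period ^ 3 * period ^ (n - 3) = period ^ n"
    using n by (simp add: power_add[symmetric])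
  ultimately show ?thesis by simp
qed

lemma spread_subset: "spread \<subseteq> {1..n} \<rightarrow>\<^sub>E {1..}"
proof
  fix w assume "w \<in> spread"
  then obtain x s where w: "w = perturb x s" "x \<in># T" "s \<in> markings x"
    by (auto simp: spread_def marked_tuples_def)
  then show "w \<in> {1..n} \<rightarrow>\<^sub>E {1..}"
    using perturb_step(2)[OF w(2,3)] by (auto simp: PiE_iff) (simp add: perturb_def)
qed

text \<open>
  The factor \<open>D\<close> is the same in both sizes, so that the proportion of the common part is preserved
  exactly.
\<close>
lemma multiset_realized_by_set:
  assumes "\<And>i k m. 1 \<le> i \<Longrightarrow> i \<le> k \<Longrightarrow> k < m \<Longrightarrow> m \<le> n \<Longrightarrow> K \<subseteq># image_mset (block_pair i k m) T"
  shows "\<exists>W D. W \<subseteq> {1..n} \<rightarrow>\<^sub>E {1..} \<and> finite W \<and> W \<noteq> {} \<and> card W = D * size T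
    \<and> D * size K \<le> size (block_sums_inter W n)"
proof -
  have "finite spread" using finite_marked_tuples by (simp add: spread_def)
  moreover have "card spread \<noteq> 0" using card_spread period_pos T(2) by (simp add: nonempty_has_size)
  then have "spread \<noteq> {}" by auto
  ultimately show ?thesis
    using spread_subset card_spread spread_common_part[OF assms] by blast
qed

end

section \<open>Block sums give merging measures on triples\<close>

text \<open>
  What the two actions have in common. The dyadic points of \<open>(0,1)\<close> are required to be in \<open>X\<close> in order to
  have room for configurations of arbitrarily many points.
\<close>
locale transitive_PL_action =
  fixes G :: "(real \<Rightarrow> real) monoid" and X :: "real set"
  assumes action: "group_action G X (eval_action X)"
    and carrier_PL: "carrier G \<subseteq> PL_homeos"
    and dyadics_in_01: "dyadic_rationals \<inter> {0<..<1} \<subseteq> X" and X_dyadic: "X \<subseteq> dyadic_rationals"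
    and interpolation: "\<And>n y q. (\<And>j. j \<le> n \<Longrightarrow> y j \<in> X \<and> q j \<in> X) \<Longrightarrow>
      (\<And>j. j < n \<Longrightarrow> y j < y (Suc j) \<and> q j < q (Suc j)) \<Longrightarrow> \<exists>g\<in>carrier G. \<forall>j\<le>n. g (y j) = q j"
begin

abbreviation "triples \<equiv> nsets X 3"
abbreviation "triple_action \<equiv> induced_action 3 X (eval_action X)"

lemma triple_action_eq: "A \<in> triples \<Longrightarrow> triple_action g A = g ` A"
  by (auto simp: induced_action_def eval_action_def nsets_def subset_iff image_iff)

lemma group_action_triples: "group_action G triples triple_action"
  by (rule group_action.group_action_induced[OF action])

lemma countable_carrier: "countable (carrier G)"
  using carrier_PL countable_PL_homeos by (rule countable_subset)

lemma countable_triples: "countable triples"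
proof (rule countable_subset)
  show "triples \<subseteq> {A. finite A \<and> A \<subseteq> X}" by (auto simp: nsets_def)
  show "countable {A. finite A \<and> A \<subseteq> X}"
    using countable_subset[OF X_dyadic countable_dyadic_rationals] by (rule countable_Collect_finite_subset)
qed

end

lemma nat_set_card_3:
  assumes "card (J :: nat set) = 3"
  shows "\<exists>i k m. i < k \<and> k < m \<and> J = {i, k, m}"
proof -
  obtain a b c where J: "J = {a, b, c}" and d: "a \<noteq> b" "b \<noteq> c" "a \<noteq> c"
    using assms by (auto simp: card_3_iff)
  define i m where "i = Min J" and "m = Max J"
  have J': "finite J" "J \<noteq> {}" using J by auto
  have "i \<in> J" "m \<in> J" using J' by (simp_all add: i_def m_def)
  moreover have bounds: "i \<le> j" "j \<le> m" if "j \<in> J" for j using J' that by (simp_all add: i_def m_def)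
  ultimately have "i \<noteq> m" using J d by (metis insertI1 insertI2 le_antisym)
  have "card (J - {i, m}) = 1"
    using assms \<open>i \<in> J\<close> \<open>m \<in> J\<close> \<open>i \<noteq> m\<close> by (simp add: card_Diff_subset)
  then obtain k where k: "J - {i, m} = {k}" by (rule card_1_singletonE)
  then have "k \<in> J" "k \<noteq> i" "k \<noteq> m" by auto
  moreover have "J = {i, k, m}" using k \<open>i \<in> J\<close> \<open>m \<in> J\<close> by auto
  ultimately show ?thesis using bounds[of k] by (metis le_neq_implies_less)
qed

lemma increasing_seq_less:
  fixes y :: "nat \<Rightarrow> 'a::order"
  assumes "\<And>j. j < n \<Longrightarrow> y j < y (Suc j)" "i < k" "k \<le> n"
  shows "y i < y k"
proof -
  have "k \<le> n \<longrightarrow> y i < y k"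
    using assms(2) by (induction rule: less_Suc_induct)
      (use assms(1) in \<open>auto intro: less_trans\<close>)
  then show ?thesis using assms(3) by simp
qed

text \<open>
  Three-element subsets of an enumerated set correspond to increasing triples of indices, which is
  the form in which block sums refer to them.
\<close>
lemma finite_set_increasing_enumeration:
  fixes U :: "'a::linorder set"
  assumes U: "finite U" "card U = Suc n"
  obtains y where "\<And>j. j \<le> n \<Longrightarrow> y j \<in> U" "\<And>j. j < n \<Longrightarrow> y j < y (Suc j)"
    "\<And>A. A \<subseteq> U \<Longrightarrow> card A = 3 \<Longrightarrow> \<exists>i k m. i < k \<and> k < m \<and> m \<le> n \<and> A = {y i, y k, y m}"
proof -
  define y where "y j = sorted_list_of_set U ! j" for j
  have len: "length (sorted_list_of_set U) = Suc n" using U by simp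
  have mem: "y j \<in> U" if "j \<le> n" for j
    using nth_mem[of j "sorted_list_of_set U"] that len U by (simp add: y_def)
  have mono: "y j < y (Suc j)" if "j < n" for j
    unfolding y_def by (rule sorted_wrt_nth_less[OF strict_sorted_list_of_set]) (use that len in auto)
  have lt: "y i < y k" if "i < k" "k \<le> n" for i k using increasing_seq_less[of n y] mono that by blast
  have inj: "inj_on y {..n}"
    by (rule linorder_inj_onI) (use lt in \<open>auto simp: less_imp_neq\<close>)
  have surj: "y ` {..n} = U"
    by (rule card_subset_eq) (use U mem card_image[OF inj] in auto)
  show thesis
  proof (rule that[of y, OF mem mono])
    fix A assume A: "A \<subseteq> U" "card A = 3"
    define J where "J = {j \<in> {..n}. y j \<in> A}"
    have AJ: "A = y ` J"
    proof
      show "A \<subseteq> y ` J"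
      proof
        fix a assume "a \<in> A"
        then obtain j where "j \<in> {..n}" "a = y j" using A surj by blast
        then show "a \<in> y ` J" using \<open>a \<in> A\<close> by (auto simp: J_def)
      qed
    qed (auto simp: J_def)
    have "inj_on y J" by (rule inj_on_subset[OF inj]) (auto simp: J_def)
    then have "card J = 3" using A(2) by (simp add: AJ card_image)
    then obtain i k m where ikm: "i < k" "k < m" "J = {i, k, m}" using nat_set_card_3 by blast
    moreover have "m \<le> n" using ikm(3) by (auto simp: J_def)
    moreover have "A = {y i, y k, y m}" by (simp add: AJ ikm(3))
    ultimately show "\<exists>i k m. i < k \<and> k < m \<and> m \<le> n \<and> A = {y i, y k, y m}" by blast
  qed
qed

text \<open>
  Moving the window of summation by one step exchanges one summand, so that a uniformly distributed
  starting place hides shifts that are short compared with \<open>T\<close>.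
\<close>
lemma sum_shift_bound:
  fixes F :: "nat \<Rightarrow> real"
  assumes "\<And>t. \<bar>F t\<bar> \<le> 1"
  shows "\<bar>(\<Sum>t<T. F (t + s)) - (\<Sum>t<T. F t)\<bar> \<le> 2 * real s"
proof (induction s)
  case (Suc s)
  have "(\<Sum>t<T. F (t + Suc s)) - (\<Sum>t<T. F (t + s)) = F (T + s) - F s"
    using sum_lessThan_telescope[of "\<lambda>t. F (t + s)" T] by (simp add: sum_subtractf)
  moreover have "\<bar>F (T + s) - F s\<bar> \<le> 2" using assms[of "T + s"] assms[of s] by linarith
  ultimately have "\<bar>(\<Sum>t<T. F (t + Suc s)) - (\<Sum>t<T. F (t + s))\<bar> \<le> 2" by simp
  then show ?case using Suc by simp
qed simp

lemma sum_mset_bound: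
  fixes H :: "'a \<Rightarrow> real"
  assumes "\<And>z. \<bar>H z\<bar> \<le> B"
  shows "\<bar>\<Sum>z\<in>#M. H z\<bar> \<le> real (size M) * B"
proof (induction M)
  case (add z M)
  then show ?case using assms[of z] by (simp add: algebra_simps)
qed simp

lemma block_sums_inter_subset:
  assumes "1 \<le> i" "i \<le> k" "k < m" "m \<le> n"
  shows "block_sums_inter W n \<subseteq># block_sums W i k m"
  unfolding block_sums_inter_def
  by (rule subset_mset.cInf_lower) (use assms in \<open>auto intro!: bdd_belowI\<close>)

context transitive_PL_action
begin

text \<open>
  The random group element sends \<open>y j\<close> to the point with number \<open>t + x 1 + \<dots> + x j\<close> of a fine dyadic
  grid, where \<open>t\<close> is uniform in \<open>{0..<T}\<close> and \<open>x\<close> is uniform in \<open>W\<close>. For a triple starting at \<open>y i\<close>,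
  replacing \<open>t + x 1 + \<dots> + x i\<close> by \<open>t\<close> costs at most \<open>2 B\<close> out of \<open>T\<close>. What remains depends on the pair of
  block sums only, and these pairs agree for all triples up to the proportion \<open>\<epsilon> / 4\<close>.
\<close>
lemma nearly_merging_of_block_sums:
  assumes blocks: "\<And>n \<epsilon>. n \<ge> 3 \<Longrightarrow> (\<epsilon>::real) > 0 \<Longrightarrow> \<exists>W. W \<subseteq> ({1..n} \<rightarrow>\<^sub>E {1..}) \<and> finite W \<and> W \<noteq> {} \<and>
        real (size (block_sums_inter W n)) \<ge> (1 - \<epsilon>) * real (card W)"
    and K: "finite K" "K \<subseteq> triples" and \<epsilon>: "\<epsilon> > 0"
  shows "\<exists>\<nu>. finite (set_pmf \<nu>) \<and> set_pmf \<nu> \<subseteq> carrier G \<and> nearly_merges triple_action \<nu> K \<epsilon>"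
proof -
  \<comment> \<open>Four additional points ensure \<open>n \<ge> 3\<close>, even when \<open>K\<close> has few elements.\<close>
  define U where "U = \<Union>K \<union> {1/8, 2/8, 3/8, 4/8}"
  have "{1/8, 2/8, 3/8, 4/8} \<subseteq> X"
  proof -
    have "of_int a / 2 ^ 3 \<in> dyadic_rationals" for a unfolding dyadic_rationals_def by blast
    from this[of 1] this[of 2] this[of 3] this[of 4] show ?thesis
      by (intro subset_trans[OF _ dyadics_in_01]) auto
  qed
  then have U: "finite U" "U \<subseteq> X" using K by (auto simp: U_def nsets_def)
  have "card {1/8, 2/8, 3/8, 4/8 :: real} \<le> card U"
    by (rule card_mono[OF U(1)]) (auto simp: U_def)
  then have "card U \<ge> 4" by simp
  then obtain n where n: "card U = Suc n" "n \<ge> 3" by (cases "card U") auto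
  obtain y where y: "\<And>j. j \<le> n \<Longrightarrow> y j \<in> U" "\<And>j. j < n \<Longrightarrow> y j < y (Suc j)"
    and trip: "\<And>A. A \<subseteq> U \<Longrightarrow> card A = 3 \<Longrightarrow> \<exists>i k m. i < k \<and> k < m \<and> m \<le> n \<and> A = {y i, y k, y m}"
    using finite_set_increasing_enumeration[OF U(1) n(1)] by blast
  obtain W where W: "W \<subseteq> ({1..n} \<rightarrow>\<^sub>E {1..})" "finite W" "W \<noteq> {}"
    and W_inter: "real (size (block_sums_inter W n)) \<ge> (1 - \<epsilon>/4) * real (card W)"
    using blocks[OF n(2), of "\<epsilon>/4"] \<epsilon> by auto
  define B where "B = (\<Sum>x\<in>W. \<Sum>j=1..n. x j)"
  have B: "(\<Sum>l=1..j. x l) \<le> B" if "x \<in> W" "j \<le> n" for x j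
  proof -
    have "(\<Sum>l=1..j. x l) \<le> (\<Sum>l=1..n. x l)" using that by (intro sum_mono2) auto
    also have "\<dots> \<le> B" unfolding B_def by (rule member_le_sum[OF that(1)]) (use W in auto)
    finally show ?thesis .
  qed
  define T where "T = nat \<lceil>8 * real B / \<epsilon>\<rceil> + 1"
  have T: "T > 0" "8 * real B \<le> \<epsilon> * real T"
  proof -
    have "8 * real B / \<epsilon> \<le> real T" unfolding T_def by linarith
    then show "8 * real B \<le> \<epsilon> * real T" using \<epsilon> by (simp add: field_simps)
  qed (simp add: T_def)
  \<comment> \<open>The grid of mesh \<open>1 / 2 ^ L\<close> has enough points in \<open>(0,1)\<close> for all positions that occur.\<close>
  define L where "L = 1 + T + B"
  have L: "real (1 + T + B) < 2 ^ L" unfolding L_def by (rule of_nat_less_two_power)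
  define pt where "pt u = real (Suc u) / 2 ^ L" for u
  define pos where "pos t x j = pt (t + (\<Sum>l=1..j. x l))" for t x and j :: nat
  have pt01: "pt u \<in> {0<..<1}" if "real (Suc u) < 2 ^ L" for u using that by (simp add: pt_def)
  have pos_X: "pos t x j \<in> X" if "t < T" "x \<in> W" "j \<le> n" for t x j
  proof -
    have "pos t x j = of_int (int (Suc (t + (\<Sum>l=1..j. x l)))) / 2 ^ L" by (simp add: pos_def pt_def)
    then have "pos t x j \<in> dyadic_rationals" unfolding dyadic_rationals_def by blast
    moreover have "real (Suc (t + (\<Sum>l=1..j. x l))) < 2 ^ L" using B[OF that(2,3)] that(1) L by linarith
    then have "pos t x j \<in> {0<..<1}" unfolding pos_def by (rule pt01)
    ultimately show ?thesis using dyadics_in_01 by blast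
  qed
  have pos_mono: "pos t x j < pos t x (Suc j)" if "x \<in> W" "j < n" for t x j
  proof -
    have "x (Suc j) \<ge> 1" using W(1) that by (force simp: PiE_iff)
    then show ?thesis by (simp add: pos_def pt_def divide_strict_right_mono)
  qed
  have "\<exists>g\<in>carrier G. \<forall>j\<le>n. g (y j) = pos (fst p) (snd p) j" if "p \<in> {..<T} \<times> W" for p
    by (rule interpolation) (use that y U pos_X pos_mono in auto)
  then have "\<forall>p\<in>{..<T} \<times> W. \<exists>h. h \<in> carrier G \<and> (\<forall>j\<le>n. h (y j) = pos (fst p) (snd p) j)"
    by (simp only: Bex_def) blast
  then have "\<exists>g. \<forall>p\<in>{..<T} \<times> W. g p \<in> carrier G \<and> (\<forall>j\<le>n. g p (y j) = pos (fst p) (snd p) j)"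
    by (rule bchoice)
  then obtain g where g_all: "\<forall>p\<in>{..<T} \<times> W. g p \<in> carrier G \<and> (\<forall>j\<le>n. g p (y j) = pos (fst p) (snd p) j)"
    by (rule exE)
  have g: "g p \<in> carrier G" and gy: "j \<le> n \<Longrightarrow> g p (y j) = pos (fst p) (snd p) j"
    if "p \<in> {..<T} \<times> W" for p j
    using bspec[OF g_all that] by simp_all
  have fin: "finite ({..<T} \<times> W)" "{..<T} \<times> W \<noteq> {}" using W T by auto
  define \<nu> where "\<nu> = map_pmf g (pmf_of_set ({..<T} \<times> W))"
  have set_\<nu>: "set_pmf \<nu> = g ` ({..<T} \<times> W)" using fin by (simp add: \<nu>_def)
  \<comment> \<open>The triple with left end number \<open>u\<close> and distances \<open>z\<close>.\<close>
  define D where "D u z = {pt u, pt (u + fst z), pt (u + fst z + snd z)}" for u and z :: "nat \<times> nat"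
  have image: "triple_action (g (t, x)) {y i, y k, y m} = D (t + (\<Sum>l=1..i. x l)) (block_pair (i + 1) k m x)"
    if A: "{y i, y k, y m} \<in> triples" and ikm: "i < k" "k < m" "m \<le> n" and tx: "t < T" "x \<in> W" for i k m t x
  proof -
    have split: "(\<Sum>l=1..b. x l) = (\<Sum>l=1..a. x l) + (\<Sum>l=a+1..b. x l)" if "a < b" for a b
      using sum.ub_add_nat[of 1 a x "b - a"] that by simp
    have "triple_action (g (t, x)) {y i, y k, y m} = {pos t x i, pos t x k, pos t x m}"
      using triple_action_eq[OF A] gy[of "(t, x)"] ikm tx by simp
    also have "\<dots> = D (t + (\<Sum>l=1..i. x l)) (block_pair (i + 1) k m x)"
      unfolding D_def pos_def block_pair_def fst_conv snd_conv
      by (simp only: split[OF ikm(1)] split[OF ikm(2)] add.assoc)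
    finally show ?thesis .
  qed
  have "nearly_merges triple_action \<nu> K \<epsilon>"
    unfolding nearly_merges_def
  proof (intro ballI allI impI)
    fix A A' and f :: "real set \<Rightarrow> real"
    assume A: "A \<in> K" "A' \<in> K" and f: "\<forall>z. \<bar>f z\<bar> \<le> 1"
    define H where "H z = (\<Sum>t<T. f (D t z))" for z
    have H: "\<bar>H z\<bar> \<le> real T" for z
    proof -
      have "\<bar>H z\<bar> \<le> (\<Sum>t<T. \<bar>f (D t z)\<bar>)" unfolding H_def by (rule sum_abs)
      also have "\<dots> \<le> real T"
        using sum_bounded_above[of "{..<T}" "\<lambda>t. \<bar>f (D t z)\<bar>" 1] f by simp
      finally show ?thesis .
    qed
    \<comment> \<open>The contribution of the common part, to which the law of every triple is compared.\<close>
    define Z where "Z = (\<Sum>z\<in>#block_sums_inter W n. H z)"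
    have main: "\<bar>(\<Sum>p\<in>{..<T} \<times> W. f (triple_action (g p) A)) - Z\<bar> \<le> real (card W) * (2 * real B + real T * \<epsilon>/4)"
      if AK: "A \<in> K" for A
    proof -
      have "A \<in> triples" using AK K by blast
      then have "A \<subseteq> U" "card A = 3" using AK by (auto simp: U_def nsets_def)
      then obtain i k m where ikm: "i < k" "k < m" "m \<le> n" and Aeq: "A = {y i, y k, y m}"
        using trip by blast
      have At: "{y i, y k, y m} \<in> triples" using \<open>A \<in> triples\<close> Aeq by simp
      let ?b = "block_pair (i + 1) k m"
      have "(\<Sum>p\<in>{..<T} \<times> W. f (triple_action (g p) A))
          = (\<Sum>x\<in>W. \<Sum>t<T. f (triple_action (g (t, x)) A))"
        by (subst sum.swap) (simp add: sum.cartesian_product)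
      also have "\<dots> = (\<Sum>x\<in>W. \<Sum>t<T. f (D (t + (\<Sum>l=1..i. x l)) (?b x)))"
        unfolding Aeq by (intro sum.cong refl arg_cong[of _ _ f] image[OF At ikm]) auto
      finally have 1: "(\<Sum>p\<in>{..<T} \<times> W. f (triple_action (g p) A)) = \<dots>" .
      have "\<bar>(\<Sum>x\<in>W. \<Sum>t<T. f (D (t + (\<Sum>l=1..i. x l)) (?b x))) - (\<Sum>x\<in>W. H (?b x))\<bar>
          \<le> (\<Sum>x\<in>W. \<bar>(\<Sum>t<T. f (D (t + (\<Sum>l=1..i. x l)) (?b x))) - H (?b x)\<bar>)"
        unfolding sum_subtractf[symmetric] by (rule sum_abs)
      also have "\<dots> \<le> (\<Sum>x\<in>W. 2 * real B)"
      proof (rule sum_mono)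
        fix x assume x: "x \<in> W"
        have "\<bar>(\<Sum>t<T. f (D (t + (\<Sum>l=1..i. x l)) (?b x))) - H (?b x)\<bar> \<le> 2 * real (\<Sum>l=1..i. x l)"
          unfolding H_def by (rule sum_shift_bound) (use f in simp)
        also have "\<dots> \<le> 2 * real B" using B[OF x, of i] ikm by (simp del: of_nat_sum)
        finally show "\<bar>(\<Sum>t<T. f (D (t + (\<Sum>l=1..i. x l)) (?b x))) - H (?b x)\<bar> \<le> 2 * real B" .
      qed
      finally have 2: "\<bar>(\<Sum>x\<in>W. \<Sum>t<T. f (D (t + (\<Sum>l=1..i. x l)) (?b x))) - (\<Sum>x\<in>W. H (?b x))\<bar>
          \<le> real (card W) * (2 * real B)" by simp
      define R where "R = block_sums W (i + 1) k m - block_sums_inter W n"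
      have sub: "block_sums_inter W n \<subseteq># block_sums W (i + 1) k m"
        by (rule block_sums_inter_subset) (use ikm in auto)
      then have dec: "block_sums W (i + 1) k m = block_sums_inter W n + R" by (simp add: R_def)
      have "(\<Sum>x\<in>W. H (?b x)) = (\<Sum>z\<in>#block_sums W (i + 1) k m. H z)"
        by (simp add: block_sums_eq multiset.map_comp o_def sum_unfold_sum_mset)
      also have "\<dots> = Z + (\<Sum>z\<in>#R. H z)" unfolding dec Z_def by simp
      finally have 3: "(\<Sum>x\<in>W. H (?b x)) - Z = (\<Sum>z\<in>#R. H z)" by simp
      have "size (block_sums W (i + 1) k m) = card W" by (simp add: block_sums_eq)
      then have "real (size R) \<le> \<epsilon>/4 * real (card W)"
        using W_inter unfolding dec by (simp add: algebra_simps)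
      then have "real (size R) * real T \<le> \<epsilon>/4 * real (card W) * real T" by (rule mult_right_mono) simp
      then have 4: "\<bar>(\<Sum>x\<in>W. H (?b x)) - Z\<bar> \<le> \<epsilon>/4 * real (card W) * real T"
        using sum_mset_bound[of H "real T" R] H 3 by simp
      have "real (card W) * (2 * real B + real T * \<epsilon>/4)
          = real (card W) * (2 * real B) + \<epsilon>/4 * real (card W) * real T"
        by (simp add: algebra_simps)
      then show ?thesis unfolding 1 using 2 4 by linarith
    qed
    define N where "N = real T * real (card W)"
    have N: "N > 0" using T W by (simp add: N_def card_gt_0_iff)
    have E: "measure_pmf.expectation \<nu> (\<lambda>h. f (triple_action h A))
        = (\<Sum>p\<in>{..<T} \<times> W. f (triple_action (g p) A)) / N" for A
      unfolding \<nu>_def using fin by (simp add: integral_pmf_of_set N_def card_cartesian_product)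
    have "\<bar>(\<Sum>p\<in>{..<T} \<times> W. f (triple_action (g p) A)) - (\<Sum>p\<in>{..<T} \<times> W. f (triple_action (g p) A'))\<bar>
        \<le> 2 * (real (card W) * (2 * real B + real T * \<epsilon>/4))"
      using main[OF A(1)] main[OF A(2)] by linarith
    also have "\<dots> = real (card W) * (4 * real B + real T * \<epsilon>/2)" by (simp add: algebra_simps)
    also have "\<dots> \<le> real (card W) * (real T * \<epsilon>)"
      using T(2) by (intro mult_left_mono) (auto simp: algebra_simps)
    also have "\<dots> = \<epsilon> * N" by (simp add: N_def)
    finally show "\<bar>measure_pmf.expectation \<nu> (\<lambda>h. f (triple_action h A))
        - measure_pmf.expectation \<nu> (\<lambda>h. f (triple_action h A'))\<bar> \<le> \<epsilon>"
      using N by (simp add: E diff_divide_distrib[symmetric] pos_divide_le_eq)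
  qed
  then show ?thesis using set_\<nu> fin(1) g by (intro exI[of _ \<nu>]) auto
qed

end

section \<open>Merging measures on triples give block sums\<close>

text \<open>
  Rounding the probabilities down to multiples of \<open>1 / Q\<close> on a finite set \<open>T\<close> carrying most of the mass
  replaces \<open>\<nu>\<close> by finitely many group elements with integer multiplicities.
\<close>
lemma pmf_integer_weights:
  fixes \<nu> :: "'a pmf"
  assumes \<delta>: "\<delta> > 0"
  shows "\<exists>T (c :: 'a \<Rightarrow> nat) (Q :: nat). finite T \<and> T \<subseteq> set_pmf \<nu> \<and> Q > 0 \<and>
    (\<forall>f. (\<forall>g. \<bar>f g\<bar> \<le> 1) \<longrightarrow>
      \<bar>(\<Sum>g\<in>T. real (c g) * f g) - real Q * measure_pmf.expectation \<nu> f\<bar> \<le> \<delta> * real Q)"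
proof -
  have "infsum (pmf \<nu>) (set_pmf \<nu>) = 1"
    using infsetsum_pmf_eq_1[of \<nu> "set_pmf \<nu>"] infsetsum_infsum[OF pmf_abs_summable, of \<nu> "set_pmf \<nu>"] by simp
  moreover have "pmf \<nu> summable_on set_pmf \<nu>"
    by (rule abs_summable_summable) (simp only: abs_summable_equivalent pmf_abs_summable)
  ultimately have "(pmf \<nu> has_sum 1) (set_pmf \<nu>)" using has_sum_infsum by metis
  then obtain T where T: "finite T" "T \<subseteq> set_pmf \<nu>" and mass: "dist (sum (pmf \<nu>) T) 1 \<le> \<delta>/2"
    using has_sum_finite_approximation[of "pmf \<nu>" "set_pmf \<nu>" 1 "\<delta>/2"] \<delta> by auto
  define Q where "Q = nat \<lceil>2 * real (card T) / \<delta>\<rceil> + 1"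
  have Q: "Q > 0" "real (card T) \<le> \<delta>/2 * real Q"
  proof -
    have "2 * real (card T) / \<delta> \<le> real Q" unfolding Q_def by linarith
    then show "real (card T) \<le> \<delta>/2 * real Q" using \<delta> by (simp add: field_simps)
  qed (simp add: Q_def)
  define c where "c g = nat \<lfloor>real Q * pmf \<nu> g\<rfloor>" for g
  have c: "\<bar>real (c g) - real Q * pmf \<nu> g\<bar> \<le> 1" for g
  proof -
    have "0 \<le> real Q * pmf \<nu> g" by simp
    then show ?thesis unfolding c_def by linarith
  qed
  have "\<bar>(\<Sum>g\<in>T. real (c g) * f g) - real Q * measure_pmf.expectation \<nu> f\<bar> \<le> \<delta> * real Q"
    if f: "\<forall>g. \<bar>f g\<bar> \<le> 1" for f
  proof -
    have int: "integrable (measure_pmf \<nu>) (\<lambda>g. f g * indicator S g)" for S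
      by (rule integrable_pmf_bounded[where B = 1]) (use f in \<open>auto simp: indicator_def\<close>)
    have "measure_pmf.expectation \<nu> f
        = measure_pmf.expectation \<nu> (\<lambda>g. f g * indicator T g + f g * indicator (- T) g)"
      by (rule Bochner_Integration.integral_cong) (auto simp: indicator_def)
    also have "\<dots> = measure_pmf.expectation \<nu> (\<lambda>g. f g * indicator T g)
        + measure_pmf.expectation \<nu> (\<lambda>g. f g * indicator (- T) g)"
      by (rule Bochner_Integration.integral_add[OF int int])
    also have "measure_pmf.expectation \<nu> (\<lambda>g. f g * indicator T g) = (\<Sum>g\<in>T. pmf \<nu> g *\<^sub>R (f g * indicator T g))"
      by (rule integral_measure_pmf[OF T(1)]) (auto simp: indicator_def split: if_splits)
    also have "\<dots> = (\<Sum>g\<in>T. pmf \<nu> g * f g)" by (rule sum.cong) auto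
    finally have E: "measure_pmf.expectation \<nu> f
        = (\<Sum>g\<in>T. pmf \<nu> g * f g) + measure_pmf.expectation \<nu> (\<lambda>g. f g * indicator (- T) g)" .
    have "\<bar>measure_pmf.expectation \<nu> (\<lambda>g. f g * indicator (- T) g)\<bar>
        \<le> measure_pmf.expectation \<nu> (\<lambda>g. \<bar>f g * indicator (- T) g\<bar>)"
      by (rule integral_abs_bound)
    also have "\<dots> \<le> measure_pmf.expectation \<nu> (indicator (- T))"
      by (rule integral_mono[OF integrable_pmf_bounded[where B = 1] integrable_pmf_bounded[where B = 1]])
         (use f in \<open>auto simp: indicator_def\<close>)
    also have "\<dots> = 1 - sum (pmf \<nu>) T"
      using measure_pmf.prob_compl[of T \<nu>] by (simp add: measure_measure_pmf_finite[OF T(1)] Compl_eq_Diff_UNIV)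
    also have "\<dots> \<le> \<delta>/2" using mass unfolding dist_real_def by linarith
    finally have tail: "\<bar>measure_pmf.expectation \<nu> (\<lambda>g. f g * indicator (- T) g)\<bar> \<le> \<delta>/2" .
    have "\<bar>(\<Sum>g\<in>T. real (c g) * f g) - real Q * (\<Sum>g\<in>T. pmf \<nu> g * f g)\<bar>
        = \<bar>\<Sum>g\<in>T. (real (c g) - real Q * pmf \<nu> g) * f g\<bar>"
      by (simp add: sum_distrib_left sum_subtractf algebra_simps)
    also have "\<dots> \<le> (\<Sum>g\<in>T. \<bar>(real (c g) - real Q * pmf \<nu> g) * f g\<bar>)" by (rule sum_abs)
    also have "\<dots> \<le> (\<Sum>g\<in>T. 1)"
      unfolding abs_mult by (intro sum_mono mult_le_one c) (use f in auto)
    finally have "\<bar>(\<Sum>g\<in>T. real (c g) * f g) - real Q * (\<Sum>g\<in>T. pmf \<nu> g * f g)\<bar> \<le> \<delta>/2 * real Q"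
      using Q(2) by simp
    moreover have "\<bar>real Q * measure_pmf.expectation \<nu> (\<lambda>g. f g * indicator (- T) g)\<bar> \<le> real Q * (\<delta>/2)"
      unfolding abs_mult abs_of_nat using tail by (rule mult_left_mono) simp
    moreover have "real Q * (\<delta>/2) = \<delta>/2 * real Q" "\<delta> * real Q = \<delta>/2 * real Q + \<delta>/2 * real Q" by simp_all
    ultimately show ?thesis unfolding E distrib_left by linarith
  qed
  then show ?thesis using T Q(1) by blast
qed

lemma size_diff_eq_filter:
  "\<exists>P. size (M - N) + size (filter_mset P N) = size (filter_mset P M)"
proof -
  define P where "P z \<longleftrightarrow> count N z < count M z" for z
  have "M - N = filter_mset P M - filter_mset P N" by (rule multiset_eqI) (simp add: P_def)
  moreover have "filter_mset P N \<subseteq># filter_mset P M" by (rule mset_subset_eqI) (simp add: P_def)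
  ultimately have "size (M - N) + size (filter_mset P N) = size (filter_mset P M)"
    by (metis size_Diff_submset size_mset_mono le_add_diff_inverse2)
  then show ?thesis by blast
qed

text \<open>
  Removing from \<open>M\<close> its excess over each \<open>N t\<close> leaves a part common to all of them. The excesses are
  what total variation controls.
\<close>
lemma common_submultiset:
  assumes I: "finite I"
  shows "\<exists>K. (\<forall>t\<in>I. K \<subseteq># N t) \<and> size M \<le> size K + (\<Sum>t\<in>I. size (M - N t))"
proof -
  define D where "D = (\<Sum>t\<in>I. M - N t)"
  have "M - D \<subseteq># N t" if "t \<in> I" for t
  proof (rule mset_subset_eqI)
    fix z
    have "count (M - N t) z \<le> (\<Sum>t\<in>I. count (M - N t) z)"
      by (rule member_le_sum[OF that]) (use I in auto)
    then have "count M z - count (N t) z \<le> count D z" unfolding D_def count_sum by simp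
    then show "count (M - D) z \<le> count (N t) z" by simp
  qed
  moreover have "size M \<le> size (M - D) + size D" using diff_size_le_size_Diff[of M D] by linarith
  ultimately show ?thesis using size_sum_msets[OF I, of "\<lambda>t. M - N t"] by (metis D_def)
qed

lemma dyadic_common_denominator:
  assumes "finite S" "S \<subseteq> dyadic_rationals"
  shows "\<exists>L::nat. \<forall>x\<in>S. x * 2 ^ L \<in> \<int>"
  using assms
proof (induction S rule: finite_induct)
  case (insert x S)
  then obtain L where L: "\<forall>x\<in>S. x * 2 ^ L \<in> \<int>" by auto
  obtain a :: int and k where x: "x = of_int a / 2 ^ k" using insert.prems by (auto simp: dyadic_rationals_def)
  have "z * 2 ^ (L + k) \<in> \<int>" if "z \<in> S" for z
    using Ints_mult[OF bspec[OF L that] Ints_of_int[of "2 ^ k"]] by (simp add: power_add mult.assoc)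
  moreover have "x * 2 ^ (L + k) = of_int (a * 2 ^ L)" by (simp add: x power_add)
  ultimately show ?case by (intro exI[of _ "L + k"]) (auto simp only: insert_iff Ints_of_int)
qed simp

text \<open>
  The two distances between neighbours in a set of three points of a grid with mesh \<open>1 / 2 ^ L\<close>. It
  is a function of the unordered triple, as required for a test function on triples.
\<close>
definition gap_pair :: "nat \<Rightarrow> real set \<Rightarrow> nat \<times> nat" where
  "gap_pair L A = (let l = sorted_list_of_set A in
     (nat \<lfloor>(l ! 1 - l ! 0) * 2 ^ L\<rfloor>, nat \<lfloor>(l ! 2 - l ! 1) * 2 ^ L\<rfloor>))"

lemma gap_pair_sorted:
  assumes "a < b" "b < c"
  shows "gap_pair L {a, b, c} = (nat \<lfloor>(b - a) * 2 ^ L\<rfloor>, nat \<lfloor>(c - b) * 2 ^ L\<rfloor>)"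
proof -
  have "sorted_list_of_set (set [a, b, c]) = [a, b, c]"
    by (rule sorted_list_of_set.idem_if_sorted_distinct) (use assms in auto)
  then show ?thesis by (simp add: gap_pair_def)
qed

context transitive_PL_action
begin

text \<open>
  The group elements of a finitely supported approximation of a merging measure, with their integer
  weights, give a multiset \<open>M\<close> of distance tuples of the images of \<open>y 0 < \<dots> < y n\<close>. A set \<open>P\<close> of pairs that
  occur more often for one triple than for another one defines a test function on triples, and the
  merging property bounds the excess. The common part of the multisets for all triples is therefore
  almost as large as \<open>M\<close>, and \<open>multiset_realized_by_set\<close> turns \<open>M\<close> into a set.
\<close>
lemma block_sums_of_Liouville:
  assumes Liou: "Liouville G triples triple_action" and n: "n \<ge> 3" and \<epsilon>: "\<epsilon> > 0"
  shows "\<exists>W. W \<subseteq> ({1..n} \<rightarrow>\<^sub>E {1..}) \<and> finite W \<and> W \<noteq> {} \<and>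
        real (size (block_sums_inter W n)) \<ge> (1 - \<epsilon>) * real (card W)"
proof -
  define y where "y j = real (Suc j) / 2 ^ (n + 2)" for j
  have y_mono: "y i < y j \<longleftrightarrow> i < j" for i j by (simp add: y_def divide_less_cancel)
  have y_X: "y j \<in> X" if "j \<le> n" for j
  proof -
    have "y j = of_int (int (Suc j)) / 2 ^ (n + 2)" by (simp add: y_def)
    then have "y j \<in> dyadic_rationals" unfolding dyadic_rationals_def by blast
    moreover have "real (n + 2) < 2 ^ (n + 2)" by (rule of_nat_less_two_power)
    then have "real (Suc j) < 2 ^ (n + 2)" using that by linarith
    then have "y j \<in> {0<..<1}" by (simp add: y_def)
    ultimately show ?thesis using dyadics_in_01 by blast
  qed
  define I where "I = {(i, k, m). 1 \<le> i \<and> i \<le> k \<and> k < m \<and> m \<le> n}"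
  have I: "finite I" "(1, 1, 2) \<in> I"
  proof -
    show "finite I" by (rule finite_subset[of _ "{..n} \<times> {..n} \<times> {..n}"]) (auto simp: I_def)
  qed (use n in \<open>simp add: I_def\<close>)
  then have cardI: "card I > 0" by (auto simp: card_gt_0_iff)
  define A where "A = (\<lambda>(i, k, m). {y (i - 1), y k, y m})"
  have A_triple: "A t \<in> triples" if "t \<in> I" for t
  proof -
    obtain i k m where t: "t = (i, k, m)" by (cases t)
    have "card {y (i - 1), y k, y m} = 3"
      using that y_mono[of "i - 1" k] y_mono[of k m] y_mono[of "i - 1" m] by (auto simp: t I_def)
    then show ?thesis using that y_X by (auto simp: t A_def I_def nsets_def)
  qed
  \<comment> \<open>Each of the \<open>card I\<close> excesses is at most \<open>3 \<eta> Q\<close>, and \<open>M\<close> has at least \<open>Q / 2\<close> elements.\<close>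
  define \<eta> where "\<eta> = min (1/2) (\<epsilon> / (6 * real (card I)))"
  have \<eta>: "\<eta> > 0" "\<eta> \<le> 1/2" "6 * real (card I) * \<eta> \<le> \<epsilon>"
  proof -
    have "\<eta> \<le> \<epsilon> / (6 * real (card I))" by (simp add: \<eta>_def)
    then show "6 * real (card I) * \<eta> \<le> \<epsilon>" using cardI by (simp add: field_simps)
  qed (use \<epsilon> cardI in \<open>auto simp: \<eta>_def\<close>)
  obtain \<nu> where \<nu>: "set_pmf \<nu> \<subseteq> carrier G" and merge: "nearly_merges triple_action \<nu> (A ` I) \<eta>"
    using group_action.Liouville_imp_nearly_merging[OF group_action_triples Liou countable_triples, of "A ` I" \<eta>]
      I A_triple \<eta>(1) by blast
  obtain T c Q where T: "finite T" "T \<subseteq> set_pmf \<nu>" and Q: "Q > (0::nat)"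
    and weights: "\<And>f. (\<And>g. \<bar>f g\<bar> \<le> 1) \<Longrightarrow>
      \<bar>(\<Sum>g\<in>T. real (c g) * f g) - real Q * measure_pmf.expectation \<nu> f\<bar> \<le> \<eta> * real Q"
    using pmf_integer_weights[OF \<eta>(1), of \<nu>] by blast
  have T_PL: "g \<in> PL_homeos" if "g \<in> T" for g using that T(2) \<nu> carrier_PL by blast
  have mono: "g a < g b" if "g \<in> T" "a < b" for g a b
    using PL_homeos_strict_mono[OF T_PL[OF that(1)]] that(2) by (rule strict_monoD)
  have "\<exists>L. \<forall>x\<in>(\<lambda>(g, j). g (y j)) ` (T \<times> {..n}). x * 2 ^ L \<in> \<int>"
  proof (rule dyadic_common_denominator)
    have "g (y j) \<in> dyadic_rationals" if "g \<in> T" "j \<le> n" for g j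
      using T_PL[OF that(1)] y_X[OF that(2)] X_dyadic by (auto simp: PL_homeos_def)
    then show "(\<lambda>(g, j). g (y j)) ` (T \<times> {..n}) \<subseteq> dyadic_rationals" by auto
  qed (use T in auto)
  then obtain L where L: "\<And>g j. g \<in> T \<Longrightarrow> j \<le> n \<Longrightarrow> g (y j) * 2 ^ L \<in> \<int>" by auto
  define pos where "pos g j = \<lfloor>g (y j) * 2 ^ L\<rfloor>" for g :: "real \<Rightarrow> real" and j
  have pos: "real_of_int (pos g j) = g (y j) * 2 ^ L" if "g \<in> T" "j \<le> n" for g j
    using L[OF that] by (simp add: pos_def of_int_floor_cancel)
  have pos_mono: "pos g i < pos g j" if "g \<in> T" "i < j" "j \<le> n" for g i j
  proof -
    have "real_of_int (pos g i) < real_of_int (pos g j)"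
      using pos[of g i] pos[of g j] mono[OF that(1), of "y i" "y j"] y_mono[of i j] that by simp
    then show ?thesis by simp
  qed
  define w where "w g = (\<lambda>j\<in>{1..n}. nat (pos g j - pos g (j - 1)))" for g
  have w: "int (w g j) = pos g j - pos g (j - 1)" if "g \<in> T" "1 \<le> j" "j \<le> n" for g j
    using pos_mono[OF that(1), of "j - 1" j] that by (simp add: w_def)
  have w_PiE: "w g \<in> {1..n} \<rightarrow>\<^sub>E {1..}" if "g \<in> T" for g
  proof (rule PiE_I)
    fix j assume j: "j \<in> {1..n}"
    then have "int (w g j) > 0" using w[OF that, of j] pos_mono[OF that, of "j - 1" j] by simp
    then show "w g j \<in> {1..}" by simp
  qed (auto simp: w_def)
  have w_sum: "int (\<Sum>j=i..k. w g j) = pos g k - pos g (i - 1)" if g: "g \<in> T" and i: "1 \<le> i" "i \<le> k" "k \<le> n" for g i k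
    using i(2,3)
  proof (induction k rule: dec_induct)
    case base
    then show ?case using w[OF g i(1)] by simp
  next
    case (step k)
    then show ?case using w[OF g, of "Suc k"] i(1) by simp
  qed
  define bp where "bp = (\<lambda>(i, k, m). block_pair i k m)"
  have gap: "gap_pair L (triple_action g (A t)) = bp t (w g)" if g: "g \<in> T" and t: "t \<in> I" for g t
  proof -
    obtain i k m where t_eq: "t = (i, k, m)" by (cases t)
    have ikm: "1 \<le> i" "i \<le> k" "k < m" "m \<le> n" using t by (auto simp: t_eq I_def)
    have fl: "nat \<lfloor>(g (y b) - g (y a)) * 2 ^ L\<rfloor> = nat (pos g b - pos g a)" if "a \<le> n" "b \<le> n" for a b
    proof -
      have "(g (y b) - g (y a)) * 2 ^ L = real_of_int (pos g b - pos g a)"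
        using pos[OF g that(1)] pos[OF g that(2)] by (simp add: left_diff_distrib)
      then show ?thesis by (simp only: floor_of_int)
    qed
    have "triple_action g (A t) = {g (y (i - 1)), g (y k), g (y m)}"
      using triple_action_eq[OF A_triple[OF t], of g] by (simp add: A_def t_eq)
    also have "gap_pair L \<dots> = (nat \<lfloor>(g (y k) - g (y (i - 1))) * 2 ^ L\<rfloor>, nat \<lfloor>(g (y m) - g (y k)) * 2 ^ L\<rfloor>)"
      by (rule gap_pair_sorted) (use ikm y_mono mono[OF g] in auto)
    also have "\<dots> = (nat (pos g k - pos g (i - 1)), nat (pos g m - pos g k))"
      using fl[of "i - 1" k] fl[of k m] ikm by simp
    also have "\<dots> = bp t (w g)"
    proof -
      have "pos g k - pos g (i - 1) = int (\<Sum>j=i..k. w g j)"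
        using w_sum[OF g, of i k] ikm by simp
      moreover have "pos g m - pos g k = int (\<Sum>j=k+1..m. w g j)"
        using w_sum[OF g, of "k + 1" m] ikm by simp
      ultimately show ?thesis by (simp only: bp_def t_eq block_pair_def prod.case nat_int)
    qed
    finally show ?thesis .
  qed
  define M where "M = (\<Sum>g\<in>T. repeat_mset (c g) {#w g#})"
  define N where "N t = image_mset (bp t) M" for t
  have size_filter: "real (size (filter_mset P (N t))) = (\<Sum>g\<in>T. real (c g) * (if P (bp t (w g)) then 1 else 0))" for P t
  proof -
    have "size (filter_mset P (image_mset (bp t) (\<Sum>g\<in>S. repeat_mset (c g) {#w g#})))
        = (\<Sum>g\<in>S. c g * (if P (bp t (w g)) then 1 else 0))" if "finite S" for S
    proof -
      have rep: "size (filter_mset P (replicate_mset m z)) = m * (if P z then 1 else 0)" for m z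
        by (induction m) auto
      show ?thesis using that by (induction S rule: finite_induct) (simp_all add: rep)
    qed
    from this[OF T(1)] show ?thesis
      unfolding N_def M_def by (simp only: of_nat_sum of_nat_mult) (rule sum.cong, simp_all)
  qed
  have size_M: "size M = (\<Sum>g\<in>T. c g)" unfolding M_def by (subst size_sum_msets[OF T(1)]) simp
  have size_N: "size (N t) = size M" for t by (simp add: N_def)
  have close: "real (size (N t - N t')) \<le> 3 * \<eta> * real Q" if t: "t \<in> I" "t' \<in> I" for t t'
  proof -
    obtain P where P: "size (N t - N t') + size (filter_mset P (N t')) = size (filter_mset P (N t))"
      using size_diff_eq_filter by blast
    \<comment> \<open>The pairs of distances with property \<open>P\<close> are counted by a test function on triples.\<close>
    define f :: "real set \<Rightarrow> real" where "f B = (if P (gap_pair L B) then 1 else 0)" for B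
    have f: "\<bar>f B\<bar> \<le> 1" for B by (simp add: f_def)
    have filt: "real (size (filter_mset P (N s))) = (\<Sum>g\<in>T. real (c g) * f (triple_action g (A s)))" if "s \<in> I" for s
      unfolding size_filter by (rule sum.cong) (use gap that in \<open>auto simp: f_def\<close>)
    have "\<bar>measure_pmf.expectation \<nu> (\<lambda>g. f (triple_action g (A t)))
        - measure_pmf.expectation \<nu> (\<lambda>g. f (triple_action g (A t')))\<bar> \<le> \<eta>"
      using merge t f unfolding nearly_merges_def by blast
    then have "real Q * \<bar>measure_pmf.expectation \<nu> (\<lambda>g. f (triple_action g (A t)))
        - measure_pmf.expectation \<nu> (\<lambda>g. f (triple_action g (A t')))\<bar> \<le> real Q * \<eta>"
      by (rule mult_left_mono) simp
    then have "\<bar>real Q * measure_pmf.expectation \<nu> (\<lambda>g. f (triple_action g (A t)))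
        - real Q * measure_pmf.expectation \<nu> (\<lambda>g. f (triple_action g (A t')))\<bar> \<le> \<eta> * real Q"
      by (simp add: abs_mult right_diff_distrib[symmetric] mult.commute)
    moreover have "real (size (N t - N t')) = real (size (filter_mset P (N t))) - real (size (filter_mset P (N t')))"
      using P by linarith
    moreover have "\<bar>(\<Sum>g\<in>T. real (c g) * f (triple_action g (A s)))
        - real Q * measure_pmf.expectation \<nu> (\<lambda>g. f (triple_action g (A s)))\<bar> \<le> \<eta> * real Q" for s
      by (rule weights) (rule f)
    note this[of t] this[of t']
    ultimately show ?thesis unfolding filt[OF t(1)] filt[OF t(2)] by linarith
  qed
  have M_large: "real (size M) \<ge> real Q / 2"
  proof -
    have "\<bar>(\<Sum>g\<in>T. real (c g) * 1) - real Q * measure_pmf.expectation \<nu> (\<lambda>_. 1)\<bar> \<le> \<eta> * real Q"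
      by (rule weights) simp
    then have "\<bar>real (size M) - real Q\<bar> \<le> \<eta> * real Q" by (simp add: size_M)
    moreover have "\<eta> * real Q \<le> 1/2 * real Q" by (rule mult_right_mono) (use \<eta> in auto)
    ultimately show ?thesis by linarith
  qed
  then have "M \<noteq> {#}" using Q by auto
  obtain K where K: "\<And>t. t \<in> I \<Longrightarrow> K \<subseteq># N t"
    and size_K: "size (N (1, 1, 2)) \<le> size K + (\<Sum>t\<in>I. size (N (1, 1, 2) - N t))"
    using common_submultiset[OF I(1), of N "N (1, 1, 2)"] by blast
  have "(\<Sum>t\<in>I. real (size (N (1, 1, 2) - N t))) \<le> (\<Sum>t\<in>I. 3 * \<eta> * real Q)"
    by (intro sum_mono close I)
  also have "\<dots> = (6 * real (card I) * \<eta>) * (real Q / 2)" by simp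
  also have "\<dots> \<le> \<epsilon> * (real Q / 2)" by (rule mult_right_mono[OF \<eta>(3)]) simp
  also have "\<dots> \<le> \<epsilon> * real (size M)" by (rule mult_left_mono[OF M_large]) (use \<epsilon> in simp)
  finally have "real (\<Sum>t\<in>I. size (N (1, 1, 2) - N t)) \<le> \<epsilon> * real (size M)" by simp
  moreover have "real (size M) \<le> real (size K) + real (\<Sum>t\<in>I. size (N (1, 1, 2) - N t))"
    using size_K unfolding size_N by linarith
  ultimately have K_large: "(1 - \<epsilon>) * real (size M) \<le> real (size K)"
    by (simp add: algebra_simps)
  have M_sub: "set_mset M \<subseteq> {1..n} \<rightarrow>\<^sub>E {1..}"
  proof -
    have "set_mset (\<Sum>g\<in>S. repeat_mset (c g) {#w g#}) \<subseteq> w ` S" if "finite S" for S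
      using that by (induction S rule: finite_induct) (auto split: if_splits)
    from this[OF T(1)] show ?thesis using w_PiE by (auto simp: M_def)
  qed
  obtain W D where W: "W \<subseteq> {1..n} \<rightarrow>\<^sub>E {1..}" "finite W" "W \<noteq> {}"
    and card_W: "card W = D * size M" and D: "D * size K \<le> size (block_sums_inter W n)"
  proof -
    have "K \<subseteq># image_mset (block_pair i k m) M" if "1 \<le> i" "i \<le> k" "k < m" "m \<le> n" for i k m
      using K[of "(i, k, m)"] that by (simp add: I_def N_def bp_def)
    from multiset_realized_by_set[OF n M_sub \<open>M \<noteq> {#}\<close> this]
    show thesis using that by blast
  qed
  have "(1 - \<epsilon>) * real (card W) = real D * ((1 - \<epsilon>) * real (size M))" by (simp add: card_W)
  also have "\<dots> \<le> real D * real (size K)" by (rule mult_left_mono[OF K_large]) simp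
  also have "\<dots> \<le> real (size (block_sums_inter W n))" using D by (simp flip: of_nat_mult)
  finally show ?thesis using W by blast
qed

theorem Liouville_triples_iff_block_sums:
  "Liouville G triples triple_action \<longleftrightarrow>
    (\<forall>n\<ge>3. \<forall>\<epsilon>::real. \<epsilon> > 0 \<longrightarrow>
      (\<exists>W. W \<subseteq> ({1..n} \<rightarrow>\<^sub>E {1..}) \<and> finite W \<and> W \<noteq> {} \<and>
        real (size (block_sums_inter W n)) \<ge> (1 - \<epsilon>) * real (card W)))"
proof
  assume R: "\<forall>n\<ge>3. \<forall>\<epsilon>::real. \<epsilon> > 0 \<longrightarrow>
      (\<exists>W. W \<subseteq> ({1..n} \<rightarrow>\<^sub>E {1..}) \<and> finite W \<and> W \<noteq> {} \<and>
        real (size (block_sums_inter W n)) \<ge> (1 - \<epsilon>) * real (card W))"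
  show "Liouville G triples triple_action"
  proof (rule group_action.nearly_merging_imp_Liouville[OF group_action_triples countable_carrier countable_triples])
    fix K and \<epsilon> :: real assume "finite K" "K \<subseteq> triples" "\<epsilon> > 0"
    then show "\<exists>\<nu>. finite (set_pmf \<nu>) \<and> set_pmf \<nu> \<subseteq> carrier G \<and> nearly_merges triple_action \<nu> K \<epsilon>"
      by (intro nearly_merging_of_block_sums R[rule_format])
  qed
qed (use block_sums_of_Liouville in blast)

end

lemma transitive_PL_action_F_real: "transitive_PL_action F_real dyadic_rationals"
proof (rule transitive_PL_action.intro)
  show "group_action F_real dyadic_rationals (eval_action dyadic_rationals)" by (rule group_action_F_real)
  fix n :: nat and y q :: "nat \<Rightarrow> real"
  assume "\<And>j. j \<le> n \<Longrightarrow> y j \<in> dyadic_rationals \<and> q j \<in> dyadic_rationals"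
    "\<And>j. j < n \<Longrightarrow> y j < y (Suc j) \<and> q j < q (Suc j)"
  from PL_map_interpolating[of n y q, OF this] show "\<exists>g\<in>carrier F_real. \<forall>j\<le>n. g (y j) = q j"
    by (simp add: F_real_def)
qed (auto simp: F_real_def)

lemma transitive_PL_action_thompson_F:
  "transitive_PL_action thompson_F (dyadic_rationals \<inter> {0<..<1})"
proof (rule transitive_PL_action.intro)
  show "group_action thompson_F (dyadic_rationals \<inter> {0<..<1}) (eval_action (dyadic_rationals \<inter> {0<..<1}))"
    by (rule group_action_thompson_F)
  fix n :: nat and y q :: "nat \<Rightarrow> real"
  assume yq: "\<And>j. j \<le> n \<Longrightarrow> y j \<in> dyadic_rationals \<inter> {0<..<1} \<and> q j \<in> dyadic_rationals \<inter> {0<..<1}"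
    "\<And>j. j < n \<Longrightarrow> y j < y (Suc j) \<and> q j < q (Suc j)"
  have "0 \<in> dyadic_rationals" "1 \<in> dyadic_rationals"
    using dyadic_of_int[of 0] dyadic_of_int[of 1] by simp_all
  then obtain h where "h \<in> PL_homeos" "\<And>x. x \<notin> {0..1} \<Longrightarrow> h x = x" "\<And>j. j \<le> n \<Longrightarrow> h (y j) = q j"
    using PL_map_interpolating_supported[of 0 1 n y q] yq by metis
  then show "\<exists>g\<in>carrier thompson_F. \<forall>j\<le>n. g (y j) = q j"
    by (intro bexI[of _ h]) (auto simp: thompson_F_def)
qed (auto simp: thompson_F_def)

theorem theorem5:
  fixes G :: "(real \<Rightarrow> real) monoid" and X :: "real set"
  assumes "(G = thompson_F \<and> X = dyadic_rationals \<inter> {0<..<1}) \<or> (G = F_real \<and> X = dyadic_rationals)"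
  shows "n_Liouville 3 G X (eval_action X) \<longleftrightarrow>
    (\<forall>n\<ge>3. \<forall>\<epsilon>::real. \<epsilon> > 0 \<longrightarrow>
      (\<exists>W. W \<subseteq> ({1..n} \<rightarrow>\<^sub>E {1..}) \<and> finite W \<and> W \<noteq> {} \<and>
        real (size (block_sums_inter W n)) \<ge> (1 - \<epsilon>) * real (card W)))"
proof -
  interpret transitive_PL_action G X
    using assms transitive_PL_action_F_real transitive_PL_action_thompson_F by auto
  show ?thesis unfolding n_Liouville_def by (rule Liouville_triples_iff_block_sums)
qed

end
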